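(* Let $\lambda\in(0,2]$. For every $\varepsilon>0$ we have, for all $X\ge 1$, \[N_\lambda(X)\ll_{\varepsilon} X^{\frac{23\lambda+3}{40}+\varepsilon},\] where the implied constant depends only on $\varepsilon$. In particular, if $\lambda\in(0,1)$ then $N_\lambda(X)\ll_\lambda X^{0.65}$ for all $X\ge1$, where the implied constant depends only on $\lambda$.
   Context: For a non-zero integer $n$, $\operatorname{rad}(n)=\prod_{p\mid n}p$ is the product of the distinct primes dividing $n$. For $\lambda>0$, a triple $(a,b,c)$ of positive integers with $\gcd(a,b,c)=1$ is called an $abc$ triple of exponent $\lambda$ if $a+b=c$ and $\operatorname{rad}(abc)<c^\lambda$. $N_\lambda(X)$ denotes the number of $abc$ triples of exponent $\lambda$ with $(a,b,c)\in[1,X]^3$. The notation $f\ll_{\varepsilon} g$ means $|f|\le K g$ for a constant $K$ depending only on the subscripted parameters. *)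

theory Defs
  imports "HOL-Analysis.Analysis" "HOL-Computational_Algebra.Primes"
begin

definition rad :: "'a::factorial_semiring \<Rightarrow> 'a" where
  "rad n = (\<Prod>p\<in>prime_factors n. p)"

definition abc_triple :: "real \<Rightarrow> nat \<times> nat \<times> nat \<Rightarrow> bool" where
  "abc_triple l = (\<lambda>(a, b, c). 0 < a \<and> 0 < b \<and> 0 < c \<and> gcd (gcd a b) c = 1 \<and> a + b = c \<and>
     real (rad (a * b * c)) < real c powr l)"

definition abc_triples_upto :: "real \<Rightarrow> real \<Rightarrow> (nat \<times> nat \<times> nat) set" where
  "abc_triples_upto l X = {(a, b, c). abc_triple l (a, b, c) \<and>
     real a \<in> {1..X} \<and> real b \<in> {1..X} \<and> real c \<in> {1..X}}"

definition abc_count :: "real \<Rightarrow> real \<Rightarrow> nat" where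
  "abc_count l X = card (abc_triples_upto l X)"

text \<open>The counted set is finite, so \<^const>\<open>card\<close> is its true cardinality.\<close>

lemma finite_abc_triples_upto: "finite (abc_triples_upto l X)"
proof (rule finite_subset)
  let ?S = "{..nat \<lfloor>X\<rfloor>}"
  show "abc_triples_upto l X \<subseteq> ?S \<times> ?S \<times> ?S"
    by (auto simp: abc_triples_upto_def le_nat_floor)
  show "finite (?S \<times> ?S \<times> ?S)" by simp
qed

end

theory Submission
  imports Defs
begin

text \<open>
  Sort the primes dividing \<open>n\<close> by their exponent \<open>i \<in> {1, 2, 3, 4, \<ge> 5}\<close>. In a box where the
  five resulting radicals of \<open>a\<close>, \<open>b\<close>, \<open>c\<close> are fixed up to a factor \<open>Y\<^sup>\<delta>\<close> (and \<open>c\<close> is of order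
  \<open>Y\<close>), the following count is available. Let \<open>p\<close>, \<open>q\<close>, \<open>m\<close> be \<open>a\<close>, \<open>b\<close>, \<open>c\<close> in some order and write
  \<open>p = A x\<^sup>k\<close>, \<open>q = B y\<^sup>k\<close>, \<open>m = C f\<close> with \<open>k \<le> 3\<close>. For fixed \<open>A\<close>, \<open>B\<close>, \<open>C\<close> the ratio
  \<open>x / y\<close> is a \<open>k\<close>-th root of a fixed residue modulo \<open>C\<close>, so the points \<open>(x, y)\<close> fall into few classes,
  and within a class the determinant of two distinct points is a multiple of essentially \<open>C\<close>. Hence
  their slopes are well separated, and there are at most \<open>O(1 + P Q F / Y)\<close> points of a class in
  the box \<open>x \<le> P\<close>, \<open>y \<le> Q\<close>, \<open>f \<le> F\<close>. The triples \<open>(A, B, C)\<close> are counted by their radicals.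

  On the logarithmic scale it remains to choose which exponent classes go into \<open>x\<close>, \<open>y\<close> and \<open>f\<close>.
  Some choice always gains \<open>(17 \<mu> - 3) / 40\<close> over the trivial count \<open>Y powr \<mu>\<close>, where
  \<open>Y powr \<mu> = rad (a b c)\<close>; this is a linear programming problem.
\<close>

section \<open>The linear programming problem\<close>

text \<open>\<open>a i\<close>, \<open>b i\<close>, \<open>c i\<close> are the logarithms of the products of the primes of exponent \<open>i\<close> in the
  three integers, the third of which provides the modulus; \<open>S\<close>, \<open>T\<close>, \<open>R\<close> are the exponent classes that
  make up \<open>x\<close>, \<open>y\<close>, \<open>f\<close>. The two inequalities say that \<open>g\<close> is gained by both terms of \<open>1 + P Q F / Y\<close>.\<close>

definition strategy ::
    "(nat \<Rightarrow> real) \<Rightarrow> (nat \<Rightarrow> real) \<Rightarrow> (nat \<Rightarrow> real) \<Rightarrow> real \<Rightarrow> bool" where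
  "strategy a b c g \<longleftrightarrow> (\<exists>k S T R. k \<in> {1, 2, 3} \<and> S \<subseteq> {1..4} \<and> T \<subseteq> {1..4} \<and> R \<subseteq> {1..4} \<and>
     (\<forall>i\<in>S \<union> T. k dvd i) \<and> g \<le> sum a S + sum b T + sum c R \<and>
     g + ((\<Sum>i\<in>S. real i * a i) + (\<Sum>i\<in>T. real i * b i)) / real k + (\<Sum>i\<in>R. real i * c i)
       \<le> sum a S + sum b T + sum c R + 1)"

text \<open>The first two integers play the same role, so only the choice of the modulus matters.
  This reduces six arrangements to three.\<close>

lemma strategy_swap: "strategy a b c g \<Longrightarrow> strategy b a c g"
  unfolding strategy_def
proof (elim exE)
  fix k S T R
  assume "k \<in> {1, 2, 3} \<and> S \<subseteq> {1..4} \<and> T \<subseteq> {1..4} \<and> R \<subseteq> {1..4} \<and>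
     (\<forall>i\<in>S \<union> T. k dvd i) \<and> g \<le> sum a S + sum b T + sum c R \<and>
     g + ((\<Sum>i\<in>S. real i * a i) + (\<Sum>i\<in>T. real i * b i)) / real k + (\<Sum>i\<in>R. real i * c i)
       \<le> sum a S + sum b T + sum c R + 1"
  then show "\<exists>k S T R. k \<in> {1, 2, 3} \<and> S \<subseteq> {1..4} \<and> T \<subseteq> {1..4} \<and> R \<subseteq> {1..4} \<and>
     (\<forall>i\<in>S \<union> T. k dvd i) \<and> g \<le> sum b S + sum a T + sum c R \<and>
     g + ((\<Sum>i\<in>S. real i * b i) + (\<Sum>i\<in>T. real i * a i)) / real k + (\<Sum>i\<in>R. real i * c i)
       \<le> sum b S + sum a T + sum c R + 1"
    by (intro exI[of _ k] exI[of _ T] exI[of _ S] exI[of _ R]) (auto simp: add.commute)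
qed

text \<open>Form used by the search: each admissible choice of sets gives two strict linear
  inequalities, one of which holds. Refuting the second leaves an upper bound for a partial sum of
  coordinates.\<close>

lemma not_strategyD:
  assumes "k \<in> {1, 2, 3}" "S \<subseteq> {1..4}" "T \<subseteq> {1..4}" "R \<subseteq> {1..4}" "\<forall>i\<in>S \<union> T. k dvd i"
    and "\<not> strategy a b c g"
  shows "sum a S + sum b T + sum c R < g \<or> sum a S + sum b T + sum c R + 1 <
     g + ((\<Sum>i\<in>S. real i * a i) + (\<Sum>i\<in>T. real i * b i)) / real k + (\<Sum>i\<in>R. real i * c i)"
  using assms unfolding strategy_def by (meson not_le)

text \<open>An infeasibility proof for a linear program. The assumptions \<open>M\<close> set aside
  the case where the full radical of one integer is already worth \<open>g\<close>, which trivial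
  counting handles. Ordering the exponent-4 coordinates breaks the symmetry, so one search
  suffices.\<close>

lemma strategy_exists_sorted:
  fixes a b c :: "nat \<Rightarrow> real"
  assumes nonneg: "\<And>i. 0 \<le> a i" "\<And>i. 0 \<le> b i" "\<And>i. 0 \<le> c i"
    and V: "a 1 + 2 * a 2 + 3 * a 3 + 4 * a 4 + 5 * a 5 \<le> 1"
      "b 1 + 2 * b 2 + 3 * b 3 + 4 * b 4 + 5 * b 5 \<le> 1"
      "c 1 + 2 * c 2 + 3 * c 3 + 4 * c 4 + 5 * c 5 \<le> 1"
    and mu: "mu = a 1 + a 2 + a 3 + a 4 + a 5 + (b 1 + b 2 + b 3 + b 4 + b 5) +
      (c 1 + c 2 + c 3 + c 4 + c 5)" "mu \<le> 2"
    and g: "g = (17 * mu - 3) / 40"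
    and sorted: "b 4 \<le> a 4" "c 4 \<le> b 4"
    and M: "a 1 + a 2 + a 3 + a 4 + a 5 < g" "b 1 + b 2 + b 3 + b 4 + b 5 < g"
      "c 1 + c 2 + c 3 + c 4 + c 5 < g"
  shows "strategy a b c g \<or> strategy b c a g \<or> strategy a c b g"
proof (rule ccontr)
  assume "\<not> ?thesis"
  then have n: "\<not> strategy a b c g" "\<not> strategy b c a g" "\<not> strategy a c b g"
    by auto
  note nn = nonneg(1)[of 1] nonneg(1)[of 2] nonneg(1)[of 3] nonneg(1)[of 4] nonneg(1)[of 5]
    nonneg(2)[of 1] nonneg(2)[of 2] nonneg(2)[of 3] nonneg(2)[of 4] nonneg(2)[of 5]
    nonneg(3)[of 1] nonneg(3)[of 2] nonneg(3)[of 3] nonneg(3)[of 4] nonneg(3)[of 5]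
  note base = nn V mu g sorted
  note [simp del] = One_nat_def
  \<comment> \<open>Each step refutes the second alternative for one choice of \<open>S\<close>, \<open>T\<close>, \<open>R\<close>; the choices were
    found by a branch-and-bound search.\<close>
  have 1: "a 1 + b 1 + c 1 < g"
    using not_strategyD[OF _ _ _ _ _ n(1), of 1 "{1}" "{1}" "{1}", simplified] base by argo
  \<comment> \<open>\<open>n(1)\<close>, \<open>n(2)\<close>, \<open>n(3)\<close> are the failures
    with modulus \<open>c\<close>, \<open>a\<close>, \<open>b\<close>. For \<open>n(3)\<close> the
    three sets therefore refer to \<open>a\<close>, \<open>c\<close>, \<open>b\<close> in this
    order.\<close>
  have 2: "a 2 + b 1 + c 2 + c 4 < g"
    using not_strategyD[OF _ _ _ _ _ n(3), of 2 "{2}" "{2,4}" "{1}", simplified] 1 base by argo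
  \<comment> \<open>The first instance carries the claimed bound; the second only helps to refute
    its cost alternative.\<close>
  have 3: "a 1 + a 2 + b 2 + b 4 + c 2 + c 4 < g"
    using not_strategyD[OF _ _ _ _ _ n(2), of 2 "{2,4}" "{2,4}" "{1,2}", simplified]
      not_strategyD[OF _ _ _ _ _ n(1), of 2 "{2}" "{2}" "{1,4}", simplified] 1 2 base by argo
  have 4: "a 3 + b 1 + c 3 < g"
    using not_strategyD[OF _ _ _ _ _ n(3), of 3 "{3}" "{3}" "{1}", simplified] 1 base by argo
  have 5: "a 2 + b 2 + b 4 + c 1 + c 2 < g"
    using not_strategyD[OF _ _ _ _ _ n(1), of 2 "{2}" "{2,4}" "{1,2}", simplified] 1 2 3 base M by argo
  have 6: "a 1 + a 2 + b 1 + b 2 + c 1 + c 2 < g"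
    using not_strategyD[OF _ _ _ _ _ n(1), of 1 "{1,2}" "{1,2}" "{1,2}", simplified] 1 2 3 4 5 base M
    by argo
  have 7: "a 1 + b 3 + c 3 < g"
    using not_strategyD[OF _ _ _ _ _ n(2), of 3 "{3}" "{3}" "{1}", simplified] 1 6 base by argo
  have 8: "a 3 + b 3 + c 1 + c 2 + c 4 < g"
    using not_strategyD[OF _ _ _ _ _ n(1), of 3 "{3}" "{3}" "{1,2,4}", simplified] 1 2 3 base M by argo
  have 9: "a 1 + a 2 + a 3 + b 3 + c 3 < g"
    using not_strategyD[OF _ _ _ _ _ n(2), of 3 "{3}" "{3}" "{1,2,3}", simplified] 4 5 6 8 base M by argo
  have 10: "a 1 + b 1 + c 1 + c 3 < g"
    using not_strategyD[OF _ _ _ _ _ n(1), of 1 "{1}" "{1}" "{1,3}", simplified] 4 6 7 9 base M by argo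
  have 11: "a 1 + a 2 + a 3 + b 1 + b 3 + c 1 + c 2 < g"
    using not_strategyD[OF _ _ _ _ _ n(1), of 1 "{1,2,3}" "{1,3}" "{1,2}", simplified] 3 6 8 9 base M
    by argo
  have 12: "a 2 + a 4 + b 2 + b 4 + c 1 + c 2 < g"
    using not_strategyD[OF _ _ _ _ _ n(1), of 2 "{2,4}" "{2,4}" "{1,2}", simplified] 3 10 11 base M
    by argo
  have 13: "a 2 + a 4 + b 2 + b 4 + c 1 + c 2 + c 3 < g"
    using not_strategyD[OF _ _ _ _ _ n(1), of 2 "{2,4}" "{2,4}" "{1,2,3}", simplified] 4 9 10 11 12 base M
    by argo
  have 14: "a 1 + a 2 + a 3 + a 4 + b 1 + b 2 + b 3 + c 1 + c 2 < g"
    using not_strategyD[OF _ _ _ _ _ n(1), of 1 "{1,2,3,4}" "{1,2,3}" "{1,2}", simplified] 11 13 base M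
    by argo
  have 15: "a 1 + a 2 + a 4 + b 1 + b 2 + c 1 + c 2 + c 3 < g"
    using not_strategyD[OF _ _ _ _ _ n(1), of 1 "{1,2,4}" "{1,2}" "{1,2,3}", simplified] 10 13 14 base
    by argo
  show False
    using 14 15 base M by argo
qed

text \<open>Permuting the integers brings any order of the exponent-4 coordinates to the sorted one,
  and the conclusion is invariant under permutations by \<open>strategy_swap\<close>.\<close>

lemma strategy_exists:
  fixes a b c :: "nat \<Rightarrow> real"
  assumes nonneg: "\<And>i. 0 \<le> a i" "\<And>i. 0 \<le> b i" "\<And>i. 0 \<le> c i"
    and V: "a 1 + 2 * a 2 + 3 * a 3 + 4 * a 4 + 5 * a 5 \<le> 1"
      "b 1 + 2 * b 2 + 3 * b 3 + 4 * b 4 + 5 * b 5 \<le> 1"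
      "c 1 + 2 * c 2 + 3 * c 3 + 4 * c 4 + 5 * c 5 \<le> 1"
    and mu: "mu = a 1 + a 2 + a 3 + a 4 + a 5 + (b 1 + b 2 + b 3 + b 4 + b 5) +
      (c 1 + c 2 + c 3 + c 4 + c 5)" "mu \<le> 2"
    and g: "g = (17 * mu - 3) / 40"
    and M: "a 1 + a 2 + a 3 + a 4 + a 5 < g" "b 1 + b 2 + b 3 + b 4 + b 5 < g"
      "c 1 + c 2 + c 3 + c 4 + c 5 < g"
  shows "strategy a b c g \<or> strategy b c a g \<or> strategy a c b g"
proof -
  note s = strategy_swap
  consider "b 4 \<le> a 4" "c 4 \<le> b 4" | "c 4 \<le> a 4" "b 4 \<le> c 4" | "a 4 \<le> b 4" "c 4 \<le> a 4"
    | "c 4 \<le> b 4" "a 4 \<le> c 4" | "a 4 \<le> c 4" "b 4 \<le> a 4" | "b 4 \<le> c 4" "a 4 \<le> b 4"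
    by linarith
  then show ?thesis
  proof cases
    case 1
    then show ?thesis using strategy_exists_sorted[of a b c mu g] assms by blast
  next
    case 2
    then have "strategy a c b g \<or> strategy c b a g \<or> strategy a b c g"
      using assms by (intro strategy_exists_sorted[of a c b mu g]) auto
    then show ?thesis using s by blast
  next
    case 3
    then have "strategy b a c g \<or> strategy a c b g \<or> strategy b c a g"
      using assms by (intro strategy_exists_sorted[of b a c mu g]) auto
    then show ?thesis using s by blast
  next
    case 4
    then have "strategy b c a g \<or> strategy c a b g \<or> strategy b a c g"
      using assms by (intro strategy_exists_sorted[of b c a mu g]) auto
    then show ?thesis using s by blast
  next
    case 5
    then have "strategy c a b g \<or> strategy a b c g \<or> strategy c b a g"
      using assms by (intro strategy_exists_sorted[of c a b mu g]) auto
    then show ?thesis using s by blast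
  next
    case 6
    then have "strategy c b a g \<or> strategy b a c g \<or> strategy c a b g"
      using assms by (intro strategy_exists_sorted[of c b a mu g]) auto
    then show ?thesis using s by blast
  qed
qed

section \<open>Integers with given radical and the divisor bound\<close>

text \<open>Only indices up to \<open>M\<close> can contribute a factor above 1, and there are at
  most \<open>Suc M\<close> of them.\<close>

lemma prod_le_power_of_small:
  fixes h :: "nat \<Rightarrow> real"
  assumes "finite P" "\<And>p. p \<in> P \<Longrightarrow> 0 \<le> h p" "\<And>p. p \<in> P \<Longrightarrow> h p \<le> c"
    and "\<And>p. p \<in> P \<Longrightarrow> M < p \<Longrightarrow> h p \<le> 1" "1 \<le> c"
  shows "prod h P \<le> c ^ Suc M"
proof -
  have "prod h P \<le> (\<Prod>p\<in>P. if p \<le> M then c else 1)"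
    using assms by (intro prod_mono) auto
  also have "\<dots> = c ^ card (P \<inter> {..M})"
    using assms(1) by (simp add: prod.If_cases atMost_def)
  also have "\<dots> \<le> c ^ Suc M"
    using assms(5) card_mono[of "{..M}" "P \<inter> {..M}"] by (intro power_increasing) auto
  finally show ?thesis .
qed

section \<open>Integers with a prescribed set of prime divisors\<close>

definition with_prime_factors :: "nat set \<Rightarrow> real \<Rightarrow> nat set" where
  "with_prime_factors P Y = {n. 0 < n \<and> real n \<le> Y \<and> prime_factors n = P}"

lemma finite_with_prime_factors [simp]: "finite (with_prime_factors P Y)"
  by (rule finite_subset[of _ "{..nat \<lfloor>Y\<rfloor>}"]) (auto simp: with_prime_factors_def le_nat_floor)

text \<open>Dividing by \<open>p\<close> either keeps \<open>p\<close> among the prime factors or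
  removes it, and shrinks the size bound by \<open>p\<close>. This is the recursion behind the
  count.\<close>

lemma with_prime_factors_insert:
  assumes "prime p" "p \<notin> P"
  shows "with_prime_factors (insert p P) Y \<subseteq> (\<lambda>m. p * m) `
    (with_prime_factors P (Y / p) \<union> with_prime_factors (insert p P) (Y / p))"
proof
  fix n assume n: "n \<in> with_prime_factors (insert p P) Y"
  then have "p dvd n"
    by (auto simp: with_prime_factors_def)
  then obtain m where m: "n = p * m" ..
  have p: "p > 0"
    using assms(1) prime_gt_0_nat by blast
  have m0: "m > 0"
    using n m by (auto simp: with_prime_factors_def intro!: Nat.gr0I)
  have "insert p P = insert p (prime_factors m)"
    using n m p m0 assms(1) prime_factors_product[of p m] prime_prime_factors[of p]
    by (auto simp: with_prime_factors_def)
  then have "prime_factors m = P \<or> prime_factors m = insert p P"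
    using assms(2) by (metis insert_absorb insert_ident)
  moreover have "real m \<le> Y / p"
    using n m p by (auto simp: with_prime_factors_def field_simps)
  ultimately show "n \<in> (\<lambda>m. p * m) `
      (with_prime_factors P (Y / p) \<union> with_prime_factors (insert p P) (Y / p))"
    using m m0 by (auto simp: with_prime_factors_def)
qed

text \<open>Rankin's bound: the local factor is the geometric series of
  \<open>p powr (- e * \<epsilon>)\<close> over exponents \<open>e \<ge> 1\<close>. Here the series
  is replaced by the recursion on \<open>Y\<close>.\<close>

lemma card_with_prime_factors_le:
  assumes "finite P" "\<forall>p\<in>P. prime p" "0 < \<epsilon>" "0 < Y"
  shows "real (card (with_prime_factors P Y)) \<le> (\<Prod>p\<in>P. 1 / (real p powr \<epsilon> - 1)) * Y powr \<epsilon>"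
  using assms(1,2,4)
proof (induction P arbitrary: Y)
  case empty
  have "n = 1" if "0 < n" "prime_factors n = {}" for n :: nat
    using that by (simp add: prime_factorization_empty_iff)
  then have sub: "with_prime_factors {} Y \<subseteq> {1}"
    by (auto simp: with_prime_factors_def)
  show ?case
  proof (cases "Y < 1")
    case True
    then have "with_prime_factors {} Y = {}"
      by (auto simp: with_prime_factors_def)
    then show ?thesis by simp
  next
    case False
    then have "1 \<le> Y powr \<epsilon>"
      using assms(3) by (simp add: ge_one_powr_ge_zero)
    moreover have "card (with_prime_factors {} Y) \<le> 1"
      using card_mono[OF _ sub] by simp
    ultimately show ?thesis by simp
  qed
next
  case (insert p P)
  define H where "H = (\<Prod>p\<in>P. 1 / (real p powr \<epsilon> - 1))"
  define z where "z = real p powr \<epsilon>"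
  have p: "prime p" "p > 1"
    using insert.prems prime_gt_1_nat by auto
  then have z: "z > 1"
    using assms(3) by (simp add: z_def gr_one_powr)
  \<comment> \<open>As \<open>p \<ge> 2\<close>, passing from \<open>Y\<close> to
    \<open>Y / p\<close> lowers the dyadic level \<open>n\<close>, so the recursion is well founded;
    at level 0 nothing is left to count.\<close>
  have "\<forall>Y>0. Y < 2 ^ n \<longrightarrow>
      real (card (with_prime_factors (insert p P) Y)) \<le> H * (1 / (z - 1)) * Y powr \<epsilon>" for n :: nat
  proof (induction n)
    case 0
    have "with_prime_factors (insert p P) Y = {}" if "Y < 1" for Y
      using that by (auto simp: with_prime_factors_def)
    moreover have "H \<ge> 0"
      unfolding H_def using insert.prems assms(3)
      by (intro prod_nonneg) (auto intro!: ge_one_powr_ge_zero simp: Suc_leI prime_gt_0_nat)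
    ultimately show ?case
      using z by simp
  next
    case (Suc n)
    show ?case
    proof (intro allI impI)
      fix Y :: real assume Y: "Y > 0" "Y < 2 ^ Suc n"
      have Yp: "Y / p > 0" "Y / p < 2 ^ n"
      proof -
        have "2 * (Y / p) \<le> Y"
          using p Y(1) by (simp add: field_simps)
        then show "Y / p < 2 ^ n" using Y by simp
      qed (use Y p in simp)
      have "card (with_prime_factors (insert p P) Y) \<le>
          card (with_prime_factors P (Y / p) \<union> with_prime_factors (insert p P) (Y / p))"
        by (rule surj_card_le[OF _ with_prime_factors_insert[OF p(1) insert.hyps(2)]]) simp
      also have "\<dots> \<le> card (with_prime_factors P (Y / p)) +
          card (with_prime_factors (insert p P) (Y / p))"
        by (rule card_Un_le)
      finally have "real (card (with_prime_factors (insert p P) Y)) \<le>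
          real (card (with_prime_factors P (Y / p))) +
          real (card (with_prime_factors (insert p P) (Y / p)))"
        by linarith
      also have "\<dots> \<le> H * (Y / p) powr \<epsilon> + H * (1 / (z - 1)) * (Y / p) powr \<epsilon>"
        using insert.IH[of "Y / p"] Suc.IH Yp insert.prems(1) unfolding H_def
        by (intro add_mono) auto
      also have "(Y / p) powr \<epsilon> = Y powr \<epsilon> / z"
        using Y p by (simp add: z_def powr_divide)
      \<comment> \<open>The bound reproduces itself because 1/z + 1/(z (z - 1)) = 1/(z - 1).\<close>
      also have "H * (Y powr \<epsilon> / z) + H * (1 / (z - 1)) * (Y powr \<epsilon> / z) =
          H * (1 / (z - 1)) * Y powr \<epsilon>"
        using z by (simp add: field_simps)
      finally show "real (card (with_prime_factors (insert p P) Y)) \<le>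
          H * (1 / (z - 1)) * Y powr \<epsilon>" .
    qed
  qed
  moreover obtain n :: nat where "Y < 2 ^ n"
    using real_arch_pow[of 2 Y] by auto
  ultimately show ?case
    using insert.prems(2) insert.hyps by (simp add: H_def z_def mult_ac)
qed

lemma powr_ge_2:
  assumes "0 < \<epsilon>" "nat \<lceil>2 powr (1 / \<epsilon>)\<rceil> < p"
  shows "2 \<le> real p powr \<epsilon>"
proof -
  have "2 powr (1 / \<epsilon>) \<le> real p"
    using assms(2) by linarith
  then have "(2 powr (1 / \<epsilon>)) powr \<epsilon> \<le> real p powr \<epsilon>"
    using assms(1) by (intro powr_mono2) auto
  then show ?thesis
    using assms(1) by (simp add: powr_powr)
qed

text \<open>A local factor is at most 1 once \<open>p powr \<epsilon> \<ge> 2\<close>. The finitely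
  many smaller primes cost only a constant, so \<open>K\<close> does not depend on
  \<open>P\<close>.\<close>

lemma uniform_card_with_prime_factors:
  assumes "0 < \<epsilon>"
  obtains K where "1 \<le> K" "\<And>P Y. finite P \<Longrightarrow> \<forall>p\<in>P. prime p \<Longrightarrow> 0 < Y \<Longrightarrow>
    real (card (with_prime_factors P Y)) \<le> K * Y powr \<epsilon>"
proof -
  define c where "c = max 1 (1 / (2 powr \<epsilon> - 1))"
  define M where "M = nat \<lceil>2 powr (1 / \<epsilon>)\<rceil>"
  have gt: "2 powr \<epsilon> > (1::real)"
    using assms by (simp add: gr_one_powr)
  show ?thesis
  proof (rule that)
    show "1 \<le> c ^ Suc M"
      by (intro one_le_power) (simp add: c_def)
    fix P :: "nat set" and Y :: real
    assume P: "finite P" "\<forall>p\<in>P. prime p" and Y: "0 < Y"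
    have "(\<Prod>p\<in>P. 1 / (real p powr \<epsilon> - 1)) \<le> c ^ Suc M"
    proof (rule prod_le_power_of_small)
      fix p assume p: "p \<in> P"
      then have "2 \<le> real p"
        using P prime_ge_2_nat by fastforce
      then have le: "2 powr \<epsilon> \<le> real p powr \<epsilon>"
        using assms by (intro powr_mono2) auto
      then show "0 \<le> 1 / (real p powr \<epsilon> - 1)"
        using gt by simp
      have "1 / (real p powr \<epsilon> - 1) \<le> 1 / (2 powr \<epsilon> - 1)"
        using le gt by (intro divide_left_mono) auto
      then show "1 / (real p powr \<epsilon> - 1) \<le> c"
        by (simp add: c_def)
      show "1 / (real p powr \<epsilon> - 1) \<le> 1" if "M < p"
        using powr_ge_2[of \<epsilon> p] that assms by (simp add: M_def)
    qed (use P in \<open>auto simp: c_def\<close>)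
    then show "real (card (with_prime_factors P Y)) \<le> c ^ Suc M * Y powr \<epsilon>"
      using card_with_prime_factors_le[OF P assms Y]
      by (meson mult_right_mono order_trans powr_ge_zero)
  qed
qed

lemma card_UN_le_mult:
  fixes b :: real
  assumes "finite I" "\<And>i. i \<in> I \<Longrightarrow> real (card (A i)) \<le> b"
  shows "real (card (\<Union>i\<in>I. A i)) \<le> real (card I) * b"
proof -
  have "real (card (\<Union>i\<in>I. A i)) \<le> (\<Sum>i\<in>I. real (card (A i)))"
    using card_UN_le[OF assms(1), of A] by (metis of_nat_le_iff of_nat_sum)
  also have "\<dots> \<le> real (card I) * b"
    using assms(2) by (rule sum_bounded_above)
  finally show ?thesis .
qed

section \<open>Radicals, and the counts of integers and divisors\<close>

lemma prime_factors_prod_prime_powers: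
  assumes "finite P" "\<forall>p\<in>P. prime p \<and> 0 < f p"
  shows "prime_factors (\<Prod>p\<in>P. p ^ f p :: nat) = P"
  using assms
proof (induction P)
  case (insert p P)
  then have "(\<Prod>p\<in>P. p ^ f p) \<noteq> 0" "p ^ f p \<noteq> 0"
    by (auto simp: prod_zero_iff prime_gt_0_nat)
  then show ?case
    using insert by (simp add: prime_factors_product prime_factorization_prime_power)
qed auto

lemma prime_factors_rad: "0 < (n::nat) \<Longrightarrow> prime_factors (rad n) = prime_factors n"
  using prime_factors_prod_prime_powers[of "prime_factors n" "\<lambda>_. 1"]
  by (auto simp: rad_def in_prime_factors_iff)

lemma rad_dvd:
  assumes "0 < (n::nat)"
  shows "rad n dvd n"
proof -
  have "rad n dvd (\<Prod>p\<in>prime_factors n. p ^ multiplicity p n)"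
    unfolding rad_def by (intro prod_dvd_prod dvd_power) (auto simp: prime_factors_multiplicity)
  then show ?thesis
    using prime_factorization_nat[OF assms] by simp
qed

text \<open>There are at most \<open>R\<close> values of the radical, and each determines the set of
  primes, hence leaves at most \<open>K * Y powr \<epsilon>\<close> integers.\<close>

lemma rad_count:
  assumes "0 < \<epsilon>"
  obtains K where "1 \<le> K" "\<And>Y R. 0 < Y \<Longrightarrow> 0 \<le> R \<Longrightarrow>
    finite {n::nat. 0 < n \<and> real n \<le> Y \<and> real (rad n) \<le> R} \<and>
    real (card {n::nat. 0 < n \<and> real n \<le> Y \<and> real (rad n) \<le> R}) \<le> K * Y powr \<epsilon> * R"
proof -
  obtain K where K: "1 \<le> K" "\<And>P Y. finite P \<Longrightarrow> \<forall>p\<in>P. prime p \<Longrightarrow> 0 < Y \<Longrightarrow>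
    real (card (with_prime_factors P Y)) \<le> K * Y powr \<epsilon>"
    using uniform_card_with_prime_factors[OF assms] by metis
  show ?thesis
  proof (rule that[OF K(1)], rule conjI)
    fix Y R :: real assume Y: "0 < Y" and R: "0 \<le> R"
    let ?S = "{n::nat. 0 < n \<and> real n \<le> Y \<and> real (rad n) \<le> R}"
    let ?I = "{1..nat \<lfloor>R\<rfloor>}"
    have rad: "0 < rad n" if "0 < n" for n :: nat
      using that by (auto simp: rad_def in_prime_factors_iff prime_gt_0_nat intro!: prod_pos)
    have sub: "?S \<subseteq> (\<Union>s\<in>?I. with_prime_factors (prime_factors s) Y)"
    proof
      fix n assume n: "n \<in> ?S"
      then have "rad n \<in> ?I"
        using rad[of n] by (auto simp: le_nat_floor Suc_leI)
      moreover have "n \<in> with_prime_factors (prime_factors (rad n)) Y"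
        using n by (simp add: with_prime_factors_def prime_factors_rad)
      ultimately show "n \<in> (\<Union>s\<in>?I. with_prime_factors (prime_factors s) Y)"
        by blast
    qed
    show "finite ?S"
      by (rule finite_subset[OF sub]) simp
    have "real (card ?S) \<le> real (card (\<Union>s\<in>?I. with_prime_factors (prime_factors s) Y))"
      using card_mono[OF _ sub] by simp
    also have "\<dots> \<le> real (card ?I) * (K * Y powr \<epsilon>)"
      using K(2) Y by (intro card_UN_le_mult) (auto simp: in_prime_factors_iff)
    also have "\<dots> \<le> R * (K * Y powr \<epsilon>)"
      using R K(1) by (intro mult_right_mono) auto
    finally show "real (card ?S) \<le> K * Y powr \<epsilon> * R"
      by (simp add: mult_ac)
  qed
qed

text \<open>Divisors are sorted by their set of primes. Half of \<epsilon> pays for the divisors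
  with a given set, the other half for the number of subsets of the primes of
  \<open>n\<close>.\<close>

lemma divisor_bound:
  assumes "0 < \<epsilon>"
  obtains K where "1 \<le> K" "\<And>n::nat. 0 < n \<Longrightarrow> real (card {d. d dvd n}) \<le> K * real n powr \<epsilon>"
proof -
  define e where "e = \<epsilon> / 2"
  have e: "0 < e" using assms by (simp add: e_def)
  obtain K where K: "1 \<le> K" "\<And>P Y. finite P \<Longrightarrow> \<forall>p\<in>P. prime p \<Longrightarrow> 0 < Y \<Longrightarrow>
    real (card (with_prime_factors P Y)) \<le> K * Y powr e"
    using uniform_card_with_prime_factors[OF e] by metis
  define M where "M = nat \<lceil>2 powr (1 / e)\<rceil>"
  show ?thesis
  proof (rule that[of "2 ^ Suc M * K"])
    have "(1::real) * 1 \<le> 2 ^ Suc M * K"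
      using K(1) by (intro mult_mono one_le_power) auto
    then show "1 \<le> 2 ^ Suc M * K" by simp
    fix n :: nat assume n: "0 < n"
    have sub: "{d. d dvd n} \<subseteq> (\<Union>P\<in>Pow (prime_factors n). with_prime_factors P n)"
    proof
      fix d assume "d \<in> {d. d dvd n}"
      then have d: "d dvd n" by simp
      then have "d \<in> with_prime_factors (prime_factors d) n"
        using n by (auto simp: with_prime_factors_def dvd_imp_le intro!: Nat.gr0I)
      moreover have "prime_factors d \<in> Pow (prime_factors n)"
        using dvd_prime_factors[OF _ d] n by simp
      ultimately show "d \<in> (\<Union>P\<in>Pow (prime_factors n). with_prime_factors P n)"
        by blast
    qed
    have "real (card {d. d dvd n}) \<le> real (card (\<Union>P\<in>Pow (prime_factors n). with_prime_factors P n))"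
      using card_mono[OF _ sub] by simp
    also have "\<dots> \<le> real (card (Pow (prime_factors n))) * (K * real n powr e)"
    proof (intro card_UN_le_mult)
      fix P assume "P \<in> Pow (prime_factors n)"
      then show "real (card (with_prime_factors P n)) \<le> K * real n powr e"
        using n finite_subset[of P "prime_factors n"]
        by (intro K(2)) (auto simp: in_prime_factors_iff)
    qed simp
    also have "real (card (Pow (prime_factors n))) = (\<Prod>p\<in>prime_factors n. 2)"
      by (simp add: card_Pow)
    \<comment> \<open>After each 2 is divided by \<open>p powr e\<close>, only primes up to
      \<open>M\<close> leave a factor above 1; the powers divided out multiply to
      \<open>rad n powr e\<close>, which is at most \<open>n powr e\<close>.\<close>
    also have "\<dots> = (\<Prod>p\<in>prime_factors n. 2 / real p powr e) * (\<Prod>p\<in>prime_factors n. real p powr e)"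
      by (subst prod.distrib[symmetric], intro prod.cong) (auto simp: in_prime_factors_iff)
    also have "(\<Prod>p\<in>prime_factors n. real p powr e) = real (rad n) powr e"
      by (simp add: rad_def prod_powr_distrib)
    also have "(\<Prod>p\<in>prime_factors n. 2 / real p powr e) * real (rad n) powr e \<le>
        2 ^ Suc M * real n powr e"
    proof (intro mult_mono powr_mono2)
      show "(\<Prod>p\<in>prime_factors n. 2 / real p powr e) \<le> 2 ^ Suc M"
      proof (rule prod_le_power_of_small)
        fix p assume "p \<in> prime_factors n"
        then have "1 \<le> real p"
          by (auto simp: in_prime_factors_iff Suc_leI prime_gt_0_nat)
        then have "1 \<le> real p powr e"
          using e by (simp add: ge_one_powr_ge_zero)
        then show "2 / real p powr e \<le> 2"
          using \<open>1 \<le> real p\<close> by (subst pos_divide_le_eq) auto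
        show "2 / real p powr e \<le> 1" if "M < p"
          using powr_ge_2[OF e, of p] that by (simp add: M_def)
      qed auto
      show "real (rad n) \<le> real n"
        using n rad_dvd[OF n] dvd_imp_le by simp
    qed (use e in auto)
    finally have "real (card {d. d dvd n}) \<le> 2 ^ Suc M * real n powr e * (K * real n powr e)"
      using K(1) by (simp add: mult_right_mono)
    also have "\<dots> = 2 ^ Suc M * K * real n powr (e + e)"
      unfolding powr_add by (simp only: mult_ac)
    finally show "real (card {d. d dvd n}) \<le> 2 ^ Suc M * K * real n powr \<epsilon>"
      by (simp add: e_def)
  qed
qed

section \<open>Classes of solutions of power congruences\<close>

text \<open>The least common multiple of \<open>a\<close> and \<open>b\<close> divides
  \<open>z\<close>, and it falls short of \<open>a * b\<close> by the factor \<open>gcd a b\<close>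
  only.\<close>

lemma mult_dvd_mult_of_gcd_dvd:
  fixes a b z n :: int
  assumes "a dvd z" "b dvd z" "gcd a b dvd n"
  shows "a * b dvd n * z"
proof -
  have "gcd a b * lcm a b dvd n * z"
    using assms by (intro mult_dvd_mono lcm_least)
  then show ?thesis
    using prod_gcd_lcm_int[of a b] by (metis abs_dvd_iff abs_mult)
qed

text \<open>What \<open>p\<close> does not absorb of \<open>c\<close> must go into \<open>q\<close>.
  This splits a modulus according to a factorization of \<open>u ^ k - w ^ k\<close>.\<close>

lemma div_gcd_dvd:
  fixes c p q :: int
  assumes "c dvd p * q" "c \<noteq> 0"
  shows "c div gcd p c dvd q"
proof -
  define g where "g = gcd p c"
  have g: "g \<noteq> 0" "g dvd p" "g dvd c"
    using assms by (auto simp: g_def)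
  have "coprime (c div g) (p div g)"
    unfolding g_def using assms(2) by (subst coprime_commute) (intro div_gcd_coprime, simp)
  moreover have "g * (c div g) dvd g * ((p div g) * q)"
    using assms(1) g by (simp flip: mult.assoc)
  then have "c div g dvd (p div g) * q"
    using g assms(1) by (simp add: div_dvd_iff_mult mult.commute)
  ultimately show ?thesis
    unfolding g_def by (simp add: coprime_dvd_mult_right_iff)
qed

text \<open>Solutions of \<open>u\<^sup>k = w\<^sup>k\<close> modulo \<open>C\<close> are sorted by \<open>gcd (u - w) C\<close>, which stands in for the
  choice of a root of unity modulo every prime power dividing \<open>C\<close>.\<close>

lemma square_class:
  fixes C u w u' w' :: int
  assumes "C \<noteq> 0" "C dvd u ^ 2 - w ^ 2" "C dvd u' ^ 2 - w' ^ 2" "coprime w C"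
    and g: "gcd (u - w) C = gcd (u' - w') C"
  shows "C dvd 2 * (u * w' - u' * w)"
proof -
  define g where "g = gcd (u - w) C"
  define h where "h = C div g"
  have C: "C = g * h" by (simp add: h_def g_def)
  have h: "h dvd u + w" "h dvd u' + w'"
    using div_gcd_dvd[of C "u - w" "u + w"] div_gcd_dvd[of C "u' - w'" "u' + w'"] assms
    by (auto simp: h_def g_def power2_eq_square algebra_simps)
  have g: "g dvd u - w" "g dvd u' - w'"
    using g unfolding g_def by (metis gcd_dvd1)+
  have "g dvd (u - w) * w' - (u' - w') * w" "h dvd (u + w) * w' - (u' + w') * w"
    using g h by (auto intro: dvd_diff)
  then have "g dvd u * w' - u' * w" "h dvd u * w' - u' * w"
    by (auto simp: algebra_simps)
  \<comment> \<open>A common divisor of \<open>u - w\<close> and \<open>u + w\<close> divides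
    \<open>2 * w\<close>, and \<open>w\<close> is a unit modulo \<open>C\<close>.\<close>
  moreover have "gcd g h dvd 2"
  proof -
    have "gcd g h dvd (u + w) - (u - w)"
      using g h by (meson dvd_diff dvd_trans gcd_dvd1 gcd_dvd2)
    then have "gcd g h dvd 2 * w" by (simp add: algebra_simps)
    moreover have "gcd g h dvd C"
      unfolding C by (rule dvd_mult2[OF gcd_dvd1])
    then have "coprime (gcd g h) w"
      using assms(4) by (metis coprime_commute coprime_divisors dvd_refl)
    ultimately show ?thesis
      by (simp only: coprime_dvd_mult_left_iff)
  qed
  ultimately show ?thesis
    unfolding C by (intro mult_dvd_mult_of_gcd_dvd)
qed

text \<open>First \<open>C\<close> splits into the part \<open>g\<close> where \<open>u = w\<close>
  and the part \<open>D\<close> where \<open>u / w\<close> is a root of \<open>t^2 + t + 1\<close>.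
  The two roots are told apart by comparison with a reference point \<open>(u1, w1)\<close>, which
  splits \<open>D\<close> once more. Each split loses a factor 3 at most, hence the 9.\<close>

lemma cube_class:
  fixes C u w u1 w1 u' w' :: int
  assumes "C \<noteq> 0" "C dvd u ^ 3 - w ^ 3" "C dvd u' ^ 3 - w' ^ 3" "C dvd u1 ^ 3 - w1 ^ 3"
    and coprime: "coprime w C" "coprime w1 C"
    and g: "gcd (u - w) C = g" "gcd (u' - w') C = g" "gcd (u1 - w1) C = g"
    and h: "gcd (u * w1 - u1 * w) (C div g) = gcd (u' * w1 - u1 * w') (C div g)"
  shows "C dvd 9 * (u * w' - u' * w)"
proof -
  define D where "D = C div g"
  define h where "h = gcd (u * w1 - u1 * w) D"
  define l where "l = D div h"
  have C: "C = g * D" using g by (auto simp: D_def)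
  have D: "D = h * l" by (simp add: l_def h_def)
  have D0: "D \<noteq> 0" using C assms(1) by auto
  have quad: "D dvd u ^ 2 + u * w + w ^ 2" "D dvd u' ^ 2 + u' * w' + w' ^ 2"
      "D dvd u1 ^ 2 + u1 * w1 + w1 ^ 2"
    using div_gcd_dvd[of C "u - w" "u ^ 2 + u * w + w ^ 2"]
      div_gcd_dvd[of C "u' - w'" "u' ^ 2 + u' * w' + w' ^ 2"]
      div_gcd_dvd[of C "u1 - w1" "u1 ^ 2 + u1 * w1 + w1 ^ 2"] assms
    by (auto simp: D_def power2_eq_square power3_eq_cube algebra_simps)
  have cop: "coprime w d" "coprime w1 d" if "d dvd C" for d
    using coprime_divisors[OF dvd_refl that] coprime by blast+
  \<comment> \<open>If \<open>t1 = u1 / w1\<close> is one root of \<open>t^2 + t + 1\<close>, the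
    other is \<open>- 1 - t1\<close>. The two factors express that \<open>x / y\<close> is one or
    the other, with denominators cleared.\<close>
  have split: "D dvd (x * w1 - u1 * y) * (x * w1 + u1 * y + y * w1)"
    if "D dvd x ^ 2 + x * y + y ^ 2" for x y
  proof -
    have "(x * w1 - u1 * y) * (x * w1 + u1 * y + y * w1) =
        w1 ^ 2 * (x ^ 2 + x * y + y ^ 2) - y ^ 2 * (u1 ^ 2 + u1 * w1 + w1 ^ 2)"
      by (simp add: power2_eq_square algebra_simps)
    then show ?thesis
      using that quad(3) by simp
  qed
  have l: "l dvd u * w1 + u1 * w + w * w1" "l dvd u' * w1 + u1 * w' + w' * w1"
    using div_gcd_dvd[OF split[OF quad(1)] D0] div_gcd_dvd[OF split[OF quad(2)] D0]
      assms(10) by (auto simp: l_def h_def D_def)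
  have hh: "h dvd u * w1 - u1 * w" "h dvd u' * w1 - u1 * w'"
    using assms(10) unfolding h_def D_def by (metis gcd_dvd1)+
  have "h dvd (u * w1 - u1 * w) * w' - (u' * w1 - u1 * w') * w"
      "l dvd (u * w1 + u1 * w + w * w1) * w' - (u' * w1 + u1 * w' + w' * w1) * w"
    using hh l by (auto intro: dvd_diff)
  then have "h dvd w1 * (u * w' - u' * w)" "l dvd w1 * (u * w' - u' * w)"
    by (auto simp: algebra_simps)
  moreover have "h dvd C" "l dvd C"
    by (auto simp: C D)
  ultimately have hl: "h dvd u * w' - u' * w" "l dvd u * w' - u' * w"
    using cop(2) by (auto simp: coprime_dvd_mult_right_iff coprime_commute)
  \<comment> \<open>The two roots coincide only modulo divisors of the discriminant -3: a common
    divisor divides \<open>2 * u + w\<close>, hence also \<open>3 * w ^ 2\<close>.\<close>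
  have "gcd h l dvd 3"
  proof -
    let ?d = "gcd h l"
    have d: "?d dvd C" "?d dvd D" by (auto simp: C D)
    have "?d dvd (u * w1 - u1 * w) + (u * w1 + u1 * w + w * w1)"
      using hh(1) l(1) by (meson dvd_add dvd_trans gcd_dvd1 gcd_dvd2)
    then have "?d dvd w1 * (2 * u + w)" by (simp add: algebra_simps)
    then have "?d dvd 2 * u + w"
      using cop(2)[OF d(1)] by (simp add: coprime_dvd_mult_right_iff coprime_commute)
    then have "?d dvd 4 * (u ^ 2 + u * w + w ^ 2) - (2 * u + w) * (2 * u + w)"
      using quad(1) d(2) by (meson dvd_diff dvd_mult dvd_trans)
    then have "?d dvd (w * w) * 3" by (simp add: power2_eq_square algebra_simps)
    then show ?thesis
      using cop(1)[OF d(1)] by (simp add: coprime_dvd_mult_right_iff coprime_commute)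
  qed
  then have D3: "D dvd 3 * (u * w' - u' * w)"
    unfolding D using hl by (intro mult_dvd_mult_of_gcd_dvd)
  have gg: "g dvd u - w" "g dvd u' - w'" "g dvd C"
    using g by (metis gcd_dvd1 gcd_dvd2)+
  have "g dvd (u - w) * w' - (u' - w') * w"
    using gg by (auto intro: dvd_diff)
  then have "g dvd u * w' - u' * w"
    by (simp add: algebra_simps)
  then have "g dvd 3 * (u * w' - u' * w)"
    by (rule dvd_mult)
  \<comment> \<open>Substituting \<open>u = w\<close> turns the quadratic form into
    \<open>3 * w ^ 2\<close>.\<close>
  moreover have "gcd g D dvd 3"
  proof -
    let ?d = "gcd g D"
    have d: "?d dvd C" using gg(3) by (meson dvd_trans gcd_dvd1)
    have "?d dvd (u ^ 2 + u * w + w ^ 2) - (u - w) * (u + 2 * w)"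
      using gg(1) quad(1) by (meson dvd_diff dvd_mult2 dvd_trans gcd_dvd1 gcd_dvd2)
    then have "?d dvd (w * w) * 3" by (simp add: power2_eq_square algebra_simps)
    then show ?thesis
      using cop(1)[OF d] by (simp add: coprime_dvd_mult_right_iff coprime_commute)
  qed
  ultimately have "g * D dvd 3 * (3 * (u * w' - u' * w))"
    using D3 by (intro mult_dvd_mult_of_gcd_dvd)
  then show ?thesis
    by (simp add: C)
qed

text \<open>Labels are pairs of divisors of \<open>C\<close>, so the number of classes is at most
  the square of the divisor count. The constant 18 is a common multiple of the losses 1, 2 and 9 for
  the three values of \<open>k\<close>.\<close>

lemma power_congruence_classes:
  fixes V :: "(int \<times> int) set" and C :: nat
  assumes k: "k \<in> {1, 2, 3::nat}" and C: "0 < C"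
    and cop: "\<And>x y. (x, y) \<in> V \<Longrightarrow> coprime x (int C) \<and> coprime y (int C)"
    and cong: "\<And>x y x' y'. (x, y) \<in> V \<Longrightarrow> (x', y') \<in> V \<Longrightarrow> int C dvd (x * y') ^ k - (x' * y) ^ k"
  obtains f :: "int \<times> int \<Rightarrow> nat \<times> nat"
  where "f ` V \<subseteq> {d. d dvd C} \<times> {d. d dvd C}"
    "\<And>x y x' y'. (x, y) \<in> V \<Longrightarrow> (x', y') \<in> V \<Longrightarrow> f (x, y) = f (x', y') \<Longrightarrow>
      int C dvd 18 * (x * y' - x' * y)"
proof (cases "V = {}")
  case True
  then show ?thesis using that[of "\<lambda>_. (1, 1)"] by auto
next
  case False
  then obtain x0 y0 where v0: "(x0, y0) \<in> V" by auto
  \<comment> \<open>Comparison with the base point \<open>(x0, y0)\<close> turns the homogeneous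
    congruence into \<open>u ^ k = w ^ k\<close>; determinants are multiplied by the unit
    \<open>x0 * y0\<close>.\<close>
  define u where "u = (\<lambda>v::int \<times> int. fst v * y0)"
  define w where "w = (\<lambda>v::int \<times> int. x0 * snd v)"
  have C0: "int C \<noteq> 0" using C by simp
  have pow: "int C dvd u v ^ k - w v ^ k" if "v \<in> V" for v
    using cong[of "fst v" "snd v" x0 y0] that v0 by (simp add: u_def w_def)
  have copw: "coprime (w v) (int C)" if "v \<in> V" for v
    using cop[OF v0] cop[of "fst v" "snd v"] that by (simp add: w_def)
  have scale: "int C dvd 18 * (x * y' - x' * y)"
    if "int C dvd 18 * (u (x, y) * w (x', y') - u (x', y') * w (x, y))" for x y x' y'
  proof -
    have "18 * (u (x, y) * w (x', y') - u (x', y') * w (x, y)) =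
        (x0 * y0) * (18 * (x * y' - x' * y))"
      by (simp add: u_def w_def algebra_simps)
    moreover have "coprime (int C) (x0 * y0)"
      using cop[OF v0] by (simp add: coprime_commute)
    ultimately show ?thesis
      using that by (metis coprime_dvd_mult_right_iff)
  qed
  have nat_gcd: "nat (gcd z (int C)) dvd C" for z
    by (metis gcd_dvd2 gcd_ge_0_int int_nat_eq of_nat_dvd_iff)
  consider "k = 1" | "k = 2" | "k = 3" using k by auto
  then show ?thesis
  proof cases
    case 1
    show ?thesis
    proof (rule that[of "\<lambda>_. (1, 1)"])
      fix x y x' y' assume "(x, y) \<in> V" "(x', y') \<in> V"
      then have "int C dvd x * y' - x' * y"
        using cong 1 by fastforce
      then show "int C dvd 18 * (x * y' - x' * y)"
        by (rule dvd_mult)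
    qed auto
  next
    case 2
    define f where "f = (\<lambda>v. (nat (gcd (u v - w v) (int C)), 1::nat))"
    show ?thesis
    proof (rule that[of f])
      show "f ` V \<subseteq> {d. d dvd C} \<times> {d. d dvd C}"
        using nat_gcd by (auto simp: f_def)
      fix x y x' y' assume v: "(x, y) \<in> V" "(x', y') \<in> V" "f (x, y) = f (x', y')"
      then have "gcd (u (x, y) - w (x, y)) (int C) = gcd (u (x', y') - w (x', y')) (int C)"
        by (simp add: f_def nat_eq_iff)
      then have "int C dvd 2 * (u (x, y) * w (x', y') - u (x', y') * w (x, y))"
        using pow[OF v(1)] pow[OF v(2)] copw[OF v(1)] C0 2 by (intro square_class) auto
      then have "int C dvd 9 * (2 * (u (x, y) * w (x', y') - u (x', y') * w (x, y)))"
        by (rule dvd_mult)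
      then have "int C dvd 18 * (u (x, y) * w (x', y') - u (x', y') * w (x, y))"
        by simp
      then show "int C dvd 18 * (x * y' - x' * y)"
        by (rule scale)
    qed
  next
    case 3
    define G where "G = (\<lambda>v. gcd (u v - w v) (int C))"
    \<comment> \<open>The reference point for \<open>cube_class\<close> depends on the first label
      only, so points with equal first labels are compared with the same one.\<close>
    define r where "r = (\<lambda>g. SOME v. v \<in> V \<and> G v = g)"
    define H where "H = (\<lambda>v. gcd (u v * w (r (G v)) - u (r (G v)) * w v) (int C div G v))"
    define f where "f = (\<lambda>v. (nat (G v), nat (H v)))"
    have r: "r (G v) \<in> V" "G (r (G v)) = G v" if "v \<in> V" for v
      using someI[of "\<lambda>v'. v' \<in> V \<and> G v' = G v" v] that by (auto simp: r_def)
    show ?thesis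
    proof (rule that[of f])
      have "nat (H v) dvd C" for v
      proof -
        have "G v dvd int C" by (simp add: G_def)
        then have "int C div G v dvd int C"
          by (metis dvd_mult_div_cancel dvd_triv_right)
        then have "H v dvd int C"
          unfolding H_def by (rule dvd_trans[OF gcd_dvd2])
        moreover have "H v \<ge> 0" by (simp add: H_def)
        ultimately show ?thesis by (metis int_nat_eq of_nat_dvd_iff)
      qed
      then show "f ` V \<subseteq> {d. d dvd C} \<times> {d. d dvd C}"
        using nat_gcd by (auto simp: f_def G_def)
      fix x y x' y' assume v: "(x, y) \<in> V" "(x', y') \<in> V" "f (x, y) = f (x', y')"
      then have G: "G (x', y') = G (x, y)"
        by (simp add: f_def G_def nat_eq_iff)
      have "H (x, y) = H (x', y')"
        using v(3) by (simp add: f_def H_def nat_eq_iff)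
      have g1: "gcd (u (x, y) - w (x, y)) (int C) = G (x, y)"
        by (simp only: G_def)
      have g2: "gcd (u (x', y') - w (x', y')) (int C) = G (x, y)"
        using G by (simp only: G_def)
      have g3: "gcd (u (r (G (x, y))) - w (r (G (x, y)))) (int C) = G (x, y)"
        using r(2)[OF v(1)] by (simp only: G_def)
      have h: "gcd (u (x, y) * w (r (G (x, y))) - u (r (G (x, y))) * w (x, y)) (int C div G (x, y)) =
          gcd (u (x', y') * w (r (G (x, y))) - u (r (G (x, y))) * w (x', y')) (int C div G (x, y))"
        using \<open>H (x, y) = H (x', y')\<close> unfolding H_def G .
      have "int C dvd 9 * (u (x, y) * w (x', y') - u (x', y') * w (x, y))"
        by (rule cube_class[OF C0 pow[OF v(1), unfolded 3] pow[OF v(2), unfolded 3]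
            pow[OF r(1)[OF v(1)], unfolded 3] copw[OF v(1)] copw[OF r(1)[OF v(1)]] g1 g2 g3 h])
      then have "int C dvd 2 * (9 * (u (x, y) * w (x', y') - u (x', y') * w (x, y)))"
        by (rule dvd_mult)
      then have "int C dvd 18 * (u (x, y) * w (x', y') - u (x', y') * w (x, y))"
        by simp
      then show "int C dvd 18 * (x * y' - x' * y)"
        by (rule scale)
    qed
  qed
qed

section \<open>Counting points with separated slopes\<close>

text \<open>Rounding down the distance to the smallest value is injective, because the values are
  1-separated.\<close>

lemma card_separated_le:
  fixes s :: "'a \<Rightarrow> real"
  assumes "finite V" "0 \<le> b"
    and sep: "\<And>v v'. v \<in> V \<Longrightarrow> v' \<in> V \<Longrightarrow> v \<noteq> v' \<Longrightarrow> 1 \<le> \<bar>s v - s v'\<bar> \<and> \<bar>s v - s v'\<bar> \<le> b"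
  shows "real (card V) \<le> 1 + b"
proof (cases "V = {}")
  case False
  define r where "r = Min (s ` V)"
  have "r \<in> s ` V"
    unfolding r_def using assms(1) False by (intro Min_in) auto
  then obtain v0 where v0: "v0 \<in> V" "s v0 = r" by auto
  have r: "r \<le> s v" if "v \<in> V" for v
    unfolding r_def using assms(1) that by (intro Min_le) auto
  have le: "s v - r \<le> b" if "v \<in> V" for v
    using sep[OF that v0(1)] v0 assms(2) by (cases "v = v0") auto
  have "inj_on (\<lambda>v. nat \<lfloor>s v - r\<rfloor>) V"
  proof (rule inj_onI, rule ccontr)
    fix v v' assume v: "v \<in> V" "v' \<in> V" "nat \<lfloor>s v - r\<rfloor> = nat \<lfloor>s v' - r\<rfloor>" "v \<noteq> v'"
    then have "\<lfloor>s v - r\<rfloor> = \<lfloor>s v' - r\<rfloor>"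
      using r[OF v(1)] r[OF v(2)] by (simp add: nat_eq_iff)
    then have "\<bar>s v - s v'\<bar> < 1" by linarith
    then show False using sep[OF v(1,2,4)] by linarith
  qed
  moreover have "(\<lambda>v. nat \<lfloor>s v - r\<rfloor>) ` V \<subseteq> {0..nat \<lfloor>b\<rfloor>}"
    using le by (auto intro!: nat_mono floor_mono)
  ultimately have "card V \<le> card {0..nat \<lfloor>b\<rfloor>}"
    by (intro card_inj_on_le) auto
  then show ?thesis
    using assms(2) by simp linarith
qed (use assms in simp)

text \<open>Two slopes differ by the determinant over \<open>x * x'\<close>, and
  \<open>x * x'\<close> lies between \<open>(P / D)^2\<close> and \<open>P^2\<close>. Scaling slopes
  by \<open>P^2 / L\<close> makes the gaps at least 1 and the spread at most
  \<open>D^2 * B / L\<close>.\<close>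

lemma card_slopes_le:
  fixes V :: "(int \<times> int) set" and P D L B :: real
  assumes "finite V" "0 < P" "1 \<le> D" "0 < L" "0 \<le> B"
    and box: "\<And>x y. (x, y) \<in> V \<Longrightarrow> P / D \<le> x \<and> x \<le> P"
    and det: "\<And>x y x' y'. (x, y) \<in> V \<Longrightarrow> (x', y') \<in> V \<Longrightarrow> (x, y) \<noteq> (x', y') \<Longrightarrow>
      L \<le> \<bar>real_of_int (x * y' - x' * y)\<bar> \<and> \<bar>real_of_int (x * y' - x' * y)\<bar> \<le> B"
  shows "real (card V) \<le> 1 + D\<^sup>2 * B / L"
proof (rule card_separated_le[where s = "\<lambda>v. real_of_int (snd v) / real_of_int (fst v) * (P\<^sup>2 / L)"])
  fix v v' assume v: "v \<in> V" "v' \<in> V" "v \<noteq> v'"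
  obtain x y x' y' where xy: "v = (x, y)" "v' = (x', y')" by force
  define d where "d = \<bar>real_of_int (x * y' - x' * y)\<bar>"
  have d: "L \<le> d" "d \<le> B"
    using det[of x y x' y'] v xy by (auto simp: d_def)
  have PD: "P / D > 0" using assms by simp
  have x: "P / D \<le> x" "x \<le> P" "P / D \<le> x'" "x' \<le> P"
    using box v xy by auto
  then have x0: "0 < real_of_int x" "0 < real_of_int x'"
    using PD by linarith+
  have "(snd v / fst v * (P\<^sup>2 / L)) - (snd v' / fst v' * (P\<^sup>2 / L)) =
      - real_of_int (x * y' - x' * y) * (P\<^sup>2 / (L * x * x'))"
    using x0 assms(4) by (simp add: xy field_simps)
  then have "\<bar>(snd v / fst v * (P\<^sup>2 / L)) - (snd v' / fst v' * (P\<^sup>2 / L))\<bar> =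
      d * (P\<^sup>2 / (L * x * x'))"
    using x0 assms(4) by (simp only: d_def abs_mult abs_minus_cancel) simp
  also have "\<dots> = d / L * (P\<^sup>2 / (x * x'))"
    by simp
  finally have eq: "\<bar>(snd v / fst v * (P\<^sup>2 / L)) - (snd v' / fst v' * (P\<^sup>2 / L))\<bar> =
      d / L * (P\<^sup>2 / (x * x'))" .
  have "1 * 1 \<le> d / L * (P\<^sup>2 / (x * x'))"
  proof (rule mult_mono)
    have "real_of_int x * x' \<le> P * P"
      using x x0 assms(2) by (intro mult_mono) auto
    then show "1 \<le> P\<^sup>2 / (x * x')"
      using x0 by (simp add: power2_eq_square)
  qed (use d assms(4) in auto)
  moreover have "d / L * (P\<^sup>2 / (x * x')) \<le> B / L * D\<^sup>2"
  proof (rule mult_mono)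
    have "(P / D) * (P / D) \<le> real_of_int x * x'"
      using x PD x0 by (intro mult_mono) auto
    then have "P\<^sup>2 \<le> D\<^sup>2 * (real_of_int x * x')"
      using assms(3) by (simp add: field_simps power2_eq_square)
    then show "P\<^sup>2 / (x * x') \<le> D\<^sup>2"
      using x0 by (simp add: field_simps)
    show "d / L \<le> B / L" using d assms(4) by (simp add: divide_right_mono)
  qed (use x0 assms in auto)
  ultimately show "1 \<le> \<bar>(snd v / fst v * (P\<^sup>2 / L)) - (snd v' / fst v' * (P\<^sup>2 / L))\<bar> \<and>
      \<bar>(snd v / fst v * (P\<^sup>2 / L)) - (snd v' / fst v' * (P\<^sup>2 / L))\<bar> \<le> D\<^sup>2 * B / L"
    unfolding eq by (simp add: mult.commute)
qed (use assms in auto)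

text \<open>Guarantees that distinct primitive points have nonzero determinant, so that divisibility
  bounds it from below.\<close>

lemma coprime_proportional_eq:
  fixes x y x' y' :: int
  assumes "coprime x y" "coprime x' y'" "0 < x" "0 < x'" "x * y' = x' * y"
  shows "x = x' \<and> y = y'"
proof -
  have "x dvd x'" "x' dvd x"
    using assms by (metis coprime_dvd_mult_left_iff dvd_triv_left)+
  then have "x = x'"
    using assms(3,4) by (simp add: zdvd_antisym_nonneg)
  then show ?thesis using assms by simp
qed

text \<open>Inside one class \<open>C\<close> divides 18 times each nonzero determinant, so slopes
  are separated with \<open>L = C / 18\<close>. There are at most \<open>M^2\<close>
  classes.\<close>

lemma card_congruent_powers_le:
  fixes V :: "(int \<times> int) set" and P D B M :: real
  assumes k: "k \<in> {1, 2, 3::nat}" and C: "0 < C" and "finite V" "0 < P" "1 \<le> D" "0 \<le> B"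
    and box: "\<And>x y. (x, y) \<in> V \<Longrightarrow> P / D \<le> x \<and> x \<le> P"
    and cop: "\<And>x y. (x, y) \<in> V \<Longrightarrow> coprime x (int C) \<and> coprime y (int C) \<and> coprime x y"
    and cong: "\<And>x y x' y'. (x, y) \<in> V \<Longrightarrow> (x', y') \<in> V \<Longrightarrow> int C dvd (x * y') ^ k - (x' * y) ^ k"
    and det: "\<And>x y x' y'. (x, y) \<in> V \<Longrightarrow> (x', y') \<in> V \<Longrightarrow> \<bar>real_of_int (x * y' - x' * y)\<bar> \<le> B"
    and M: "real (card {d. d dvd C}) \<le> M"
  shows "real (card V) \<le> M\<^sup>2 * (1 + 18 * D\<^sup>2 * B / C)"
proof -
  obtain f where f: "f ` V \<subseteq> {d. d dvd C} \<times> {d. d dvd C}"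
    "\<And>x y x' y'. (x, y) \<in> V \<Longrightarrow> (x', y') \<in> V \<Longrightarrow> f (x, y) = f (x', y') \<Longrightarrow>
      int C dvd 18 * (x * y' - x' * y)"
    using power_congruence_classes[OF k C, of V] cop cong by metis
  let ?I = "{d. d dvd C} \<times> {d. d dvd C}"
  have finI: "finite ?I" using C by simp
  have pos: "0 < x" if "(x, y) \<in> V" for x y
  proof -
    have "0 < P / D" using assms by simp
    then show ?thesis using box[OF that] by linarith
  qed
  have "V = (\<Union>i\<in>?I. {v \<in> V. f v = i})"
    using f(1) by auto
  then have "real (card V) = real (card (\<Union>i\<in>?I. {v \<in> V. f v = i}))" by simp
  also have "\<dots> \<le> real (card ?I) * (1 + D\<^sup>2 * B / (C / 18))"
  proof (rule card_UN_le_mult[OF finI], rule card_slopes_le)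
    fix i x y x' y'
    assume v: "(x, y) \<in> {v \<in> V. f v = i}" "(x', y') \<in> {v \<in> V. f v = i}" "(x, y) \<noteq> (x', y')"
    then have "x * y' - x' * y \<noteq> 0"
      using coprime_proportional_eq[of x y x' y'] cop pos by auto
    moreover have "int C dvd 18 * (x * y' - x' * y)"
      using f(2)[of x y x' y'] v by auto
    ultimately have "\<bar>int C\<bar> \<le> \<bar>18 * (x * y' - x' * y)\<bar>"
      by (intro dvd_imp_le_int) auto
    then have "int C \<le> 18 * \<bar>x * y' - x' * y\<bar>"
      by (simp only: abs_mult)
    then have "real_of_int (int C) \<le> real_of_int (18 * \<bar>x * y' - x' * y\<bar>)"
      by (simp only: of_int_le_iff)
    then have "real C / 18 \<le> \<bar>real_of_int (x * y' - x' * y)\<bar>"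
      by (simp only: of_int_mult of_int_abs) simp
    then show "real C / 18 \<le> \<bar>real_of_int (x * y' - x' * y)\<bar> \<and> \<bar>real_of_int (x * y' - x' * y)\<bar> \<le> B"
      using det[of x y x' y'] v by auto
  qed (use assms in auto)
  also have "\<dots> = (real (card {d. d dvd C}))\<^sup>2 * (1 + 18 * D\<^sup>2 * B / C)"
    by (simp add: card_cartesian_product power2_eq_square)
  also have "\<dots> \<le> M\<^sup>2 * (1 + 18 * D\<^sup>2 * B / C)"
    using M assms by (intro mult_right_mono power_mono) auto
  finally show ?thesis .
qed

text \<open>For nonnegative \<open>u\<close> and \<open>w\<close> the cofactor of
  \<open>u - w\<close> in \<open>u ^ k - w ^ k\<close> is a sum of nonnegative terms, one of which
  is \<open>u ^ (k - 1)\<close>.\<close>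

lemma abs_power_diff_ge:
  fixes u w :: real
  assumes "0 \<le> u" "0 \<le> w" "0 < k"
  shows "\<bar>u - w\<bar> * u ^ (k - 1) \<le> \<bar>u ^ k - w ^ k\<bar>"
proof -
  obtain j where k: "k = Suc j" using assms(3) gr0_implies_Suc by blast
  show ?thesis
  proof (cases "w \<le> u")
    case True
    then have "w * w ^ j \<le> w * u ^ j" "w ^ k \<le> u ^ k"
      using assms by (auto intro!: mult_left_mono power_mono)
    then show ?thesis using True k by (simp add: algebra_simps)
  next
    case False
    then have "w * u ^ j \<le> w * w ^ j" "u ^ k \<le> w ^ k"
      using assms by (auto intro!: mult_left_mono power_mono)
    then show ?thesis using False k by (simp add: algebra_simps)
  qed
qed

text \<open>The curve \<open>a x\<^sup>k = b y\<^sup>k + m\<close> with small \<open>m\<close> stays close to a line through the origin.\<close>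

lemma abs_det_le:
  fixes a b x y x' y' m m' P Q D B Z :: real
  assumes "0 < k" "0 < a" "0 < x" "0 < y" "0 < x'" "0 < y'" "0 \<le> m" "0 \<le> m'"
    and "a * x ^ k = b * y ^ k + m" "a * x' ^ k = b * y' ^ k + m'"
    and "m \<le> B" "m' \<le> B" "y \<le> Q" "y' \<le> Q" "Q / D \<le> y'" "x \<le> P" "Z \<le> a * x ^ k" "0 < Z" "0 < D"
  shows "\<bar>x * y' - x' * y\<bar> \<le> D ^ (k - 1) * P * Q * B / Z"
proof -
  have Q: "0 < Q" using assms by linarith
  have B: "0 \<le> B" using assms by linarith
  have k: "z ^ k = z * z ^ (k - 1)" for z :: real
    using assms(1) by (simp add: power_eq_if)
  \<comment> \<open>Cross-multiplication eliminates \<open>b\<close>, so only the small terms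
    \<open>m\<close> and \<open>m'\<close> remain on the right.\<close>
  have "a * ((x * y') ^ k - (x' * y) ^ k) = y' ^ k * (a * x ^ k) - y ^ k * (a * x' ^ k)"
    by (simp add: power_mult_distrib algebra_simps)
  also have "\<dots> = y' ^ k * m - y ^ k * m'"
    unfolding assms by (simp add: algebra_simps)
  finally have eq: "a * \<bar>(x * y') ^ k - (x' * y) ^ k\<bar> = \<bar>y' ^ k * m - y ^ k * m'\<bar>"
    using assms(2) by (metis abs_mult abs_of_pos)
  have "y' ^ k * m \<le> Q ^ k * B" "y ^ k * m' \<le> Q ^ k * B"
    using assms Q by (auto intro!: mult_mono power_mono)
  moreover have "0 \<le> y' ^ k * m" "0 \<le> y ^ k * m'"
    using assms by auto
  ultimately have le: "\<bar>y' ^ k * m - y ^ k * m'\<bar> \<le> Q ^ k * B"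
    by linarith
  let ?d = "\<bar>x * y' - x' * y\<bar>"
  \<comment> \<open>Multiplying by a further \<open>x\<close> completes \<open>a * x ^ k\<close>,
    which is bounded below by \<open>Z\<close>.\<close>
  have "(Z * (Q / D) ^ (k - 1)) * ?d \<le> ((a * x ^ k) * y' ^ (k - 1)) * ?d"
    using assms Q by (intro mult_right_mono mult_mono power_mono) auto
  also have "\<dots> = x * (a * (?d * (x * y') ^ (k - 1)))"
    by (simp add: power_mult_distrib k[of x])
  also have "\<dots> \<le> x * (a * \<bar>(x * y') ^ k - (x' * y) ^ k\<bar>)"
    using assms by (intro mult_left_mono abs_power_diff_ge) auto
  also have "\<dots> \<le> P * (Q ^ k * B)"
    unfolding eq using assms le B Q by (intro mult_mono) auto
  finally have "Z * (Q ^ (k - 1) * ?d) \<le> D ^ (k - 1) * (P * (Q ^ k * B))"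
    using assms by (simp add: power_divide field_simps)
  then have "Q ^ (k - 1) * (Z * ?d) \<le> Q ^ (k - 1) * (D ^ (k - 1) * P * Q * B)"
    by (simp add: k[of Q] mult_ac)
  then have "Z * ?d \<le> D ^ (k - 1) * P * Q * B"
    using Q by (simp add: mult_le_cancel_left_pos)
  then show ?thesis
    using assms by (simp add: field_simps)
qed

section \<open>Counting factored triples\<close>

text \<open>The index \<open>j\<close> tells which entry is the sum of the other two:
  \<open>m\<close>, \<open>p\<close>, or \<open>q\<close> for every remaining value. A number is
  used so that triples can be sorted by \<open>j < 3\<close>.\<close>

definition summand_relation :: "nat \<Rightarrow> nat \<times> nat \<times> nat \<Rightarrow> bool" where
  "summand_relation j = (\<lambda>(p, q, m).
     if j = 0 then p + q = m else if j = 1 then q + m = p else p + m = q)"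

lemma summand_relation_coprime:
  assumes "summand_relation j (p, q, m)" "coprime p q"
  shows "coprime p m" "coprime q m"
proof -
  have c: "coprime a (a + b) \<longleftrightarrow> coprime a b" "coprime a (b + a) \<longleftrightarrow> coprime a b" for a b :: nat
    by (metis add.commute coprime_iff_gcd_eq_1 gcd_add2)+
  consider "m = p + q" | "p = q + m" | "q = p + m"
    using assms(1) by (auto simp: summand_relation_def split: if_splits)
  then have "coprime p m \<and> coprime q m"
  proof cases
    case 1
    then show ?thesis using assms(2) by (simp add: c coprime_commute)
  next
    case 2
    then have "coprime q m" using assms(2) c by (simp add: coprime_commute)
    then show ?thesis using 2 c by (metis coprime_commute)
  next
    case 3
    then have "coprime p m" using assms(2) c by (simp add: coprime_commute)
    then show ?thesis using 3 c by (metis coprime_commute)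
  qed
  then show "coprime p m" "coprime q m" by auto
qed

text \<open>With the cofactors and \<open>j\<close> fixed, a triple is determined by the point
  \<open>(x, y)\<close>. The congruence modulo \<open>c\<close> and the determinant bound feed
  \<open>card_congruent_powers_le\<close>, where \<open>c\<close> cancels.\<close>

lemma card_fibre_le:
  fixes W :: "(nat \<times> nat \<times> nat) set" and x y :: "nat \<Rightarrow> nat" and a b c :: nat and P Q F D Y M :: real
  assumes k: "k \<in> {1, 2, 3}" and "finite W" and pos: "1 \<le> D" "0 < P" "0 < Q" "0 \<le> F" "0 < Y"
    and rel: "\<And>t. t \<in> W \<Longrightarrow> summand_relation j t"
    and cop: "\<And>p q m. (p, q, m) \<in> W \<Longrightarrow> 0 < p \<and> 0 < q \<and> 0 < m \<and> coprime p q"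
    and size: "\<And>p q m. (p, q, m) \<in> W \<Longrightarrow> Y / 2 \<le> real (Max {p, q, m})"
    and fac: "\<And>p q m. (p, q, m) \<in> W \<Longrightarrow> p = a * x p ^ k \<and> q = b * y q ^ k \<and> c dvd m \<and> m \<le> c * F"
    and box: "\<And>p q m. (p, q, m) \<in> W \<Longrightarrow> P / D \<le> x p \<and> x p \<le> P \<and> Q / D \<le> y q \<and> y q \<le> Q"
    and M: "real (card {d. d dvd c}) \<le> M"
  shows "real (card W) \<le> M\<^sup>2 * (1 + 36 * D ^ 4 * (P * Q * F) / Y)"
proof (cases "W = {}")
  case True
  then show ?thesis using pos by simp
next
  case False
  then obtain p0 q0 m0 where t0: "(p0, q0, m0) \<in> W" by auto
  have k0: "0 < k" using k by auto
  have c: "0 < c"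
    using cop[OF t0] fac[OF t0] by (auto intro!: Nat.gr0I)
  have a: "0 < a" and b: "0 < b"
    using cop[OF t0] fac[OF t0] by (metis mult_eq_0_iff neq0_conv)+
  have xy: "0 < x p" "0 < y q" if "(p, q, m) \<in> W" for p q m
    using cop[OF that] fac[OF that] k0 by (metis mult_eq_0_iff neq0_conv zero_power)+
  \<comment> \<open>With this sign \<open>p + s * q\<close> equals \<open>m\<close> or
    \<open>- m\<close>, so all three relations give one congruence modulo \<open>c\<close>.\<close>
  define s :: int where "s = (if j = 0 then 1 else -1)"
  have lin: "int c dvd int a * int (x p) ^ k + s * (int b * int (y q) ^ k)" if "(p, q, m) \<in> W" for p q m
  proof -
    have "int a * int (x p) ^ k = int p" "int b * int (y q) ^ k = int q"
      using fac[OF that] by (metis of_nat_mult of_nat_power)+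
    moreover have "int c dvd int p + s * int q"
    proof -
      have "int c dvd int m" using fac[OF that] by simp
      moreover have "int p + s * int q = int m \<or> int p + s * int q = - int m"
        using rel[OF that] by (auto simp: summand_relation_def s_def split: if_splits)
      ultimately show ?thesis by (metis dvd_minus_iff)
    qed
    ultimately show ?thesis by simp
  qed
  have copc: "coprime a c \<and> coprime (x p) c \<and> coprime (y q) c \<and> coprime (x p) (y q)"
    if "(p, q, m) \<in> W" for p q m
  proof -
    have "x p dvd x p ^ k" "y q dvd y q ^ k"
      using k0 by (auto intro: dvd_power)
    then have d: "a dvd p" "x p dvd p" "y q dvd q" "c dvd m"
      using fac[OF that] by (metis dvd_triv_left dvd_mult)+
    have "coprime p m" "coprime q m" "coprime p q"
      using summand_relation_coprime[OF rel[OF that]] cop[OF that] by auto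
    then show ?thesis
      using d by (meson coprime_divisors)
  qed
  define g where "g = (\<lambda>(p, q, m::nat). (int (x p), int (y q)))"
  have inj: "inj_on g W"
  proof (rule inj_onI)
    fix t t' assume t: "t \<in> W" "t' \<in> W" "g t = g t'"
    obtain p q m p' q' m' where eq: "t = (p, q, m)" "t' = (p', q', m')"
      by (metis surj_pair)
    then have "p = p'" "q = q'"
      using t fac[of p q m] fac[of p' q' m'] by (auto simp: g_def)
    then show "t = t'"
      using rel[OF t(1)] rel[OF t(2)] by (auto simp: eq summand_relation_def split: if_splits)
  qed
  define B where "B = 2 * D\<^sup>2 * P * Q * (c * F) / Y"
  have cF: "0 \<le> c * F" using pos by simp
  have "real (card (g ` W)) \<le> M\<^sup>2 * (1 + 18 * D\<^sup>2 * B / c)"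
  proof (rule card_congruent_powers_le[OF k c])
    fix u v u' v' :: int assume "(u, v) \<in> g ` W" "(u', v') \<in> g ` W"
    then obtain p q m p' q' m' where t: "(p, q, m) \<in> W" "(p', q', m') \<in> W"
      and uv: "u = int (x p)" "v = int (y q)" "u' = int (x p')" "v' = int (y q')"
      by (auto simp: g_def)
    \<comment> \<open>This combination cancels the terms with \<open>b\<close>; afterwards
      \<open>a\<close> is dropped, being coprime to \<open>c\<close>.\<close>
    have "int c dvd v' ^ k * (int a * u ^ k + s * (int b * v ^ k)) -
        v ^ k * (int a * u' ^ k + s * (int b * v' ^ k))"
      using lin[OF t(1)] lin[OF t(2)] unfolding uv by (intro dvd_diff dvd_mult)
    also have "\<dots> = int a * ((u * v') ^ k - (u' * v) ^ k)"
      by (simp add: algebra_simps power_mult_distrib)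
    finally show "int c dvd (u * v') ^ k - (u' * v) ^ k"
      using copc[OF t(1)] by (simp add: coprime_dvd_mult_right_iff coprime_commute)
    note bx = box[OF t(1)] box[OF t(2)]
    note fc = fac[OF t(1)] fac[OF t(2)]
    have real_fac: "real p = a * real (x p) ^ k" "real q = b * real (y q) ^ k"
      "real p' = a * real (x p') ^ k" "real q' = b * real (y q') ^ k"
      using fc by (metis of_nat_mult of_nat_power)+
    \<comment> \<open>Here \<open>k \<le> 3\<close> matters: one determinant bound serves all values
      of \<open>k\<close>.\<close>
    have Dk: "D ^ (k - 1) \<le> D\<^sup>2"
      using k pos by (intro power_increasing) auto
    have Bk: "D ^ (k - 1) * P * Q * (c * F) / (Y / 2) \<le> B"
    proof -
      have "D ^ (k - 1) * (P * Q * (c * F) * 2 / Y) \<le> D\<^sup>2 * (P * Q * (c * F) * 2 / Y)"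
        using pos cF by (intro mult_right_mono Dk) auto
      then show ?thesis by (simp add: B_def mult_ac)
    qed
    have "\<bar>real (x p) * y q' - real (x p') * y q\<bar> \<le> B"
    proof -
      consider "j = 0" | "j = 1" | "j \<noteq> 0 \<and> j \<noteq> 1" by auto
      then show ?thesis
      proof cases
        case 1
        then have "m = p + q" "0 < q" "0 < p"
          using rel[OF t(1)] cop[OF t(1)] by (auto simp: summand_relation_def)
        then have "Y / 2 \<le> m" using size[OF t(1)] by simp
        \<comment> \<open>If \<open>m\<close> is the sum, it is not small, and the trivial bound
          \<open>P * Q\<close> for the determinant is already below \<open>B\<close>.\<close>
        then have Y: "Y / 2 \<le> c * F" using fc by linarith
        have "real (x p) * y q' \<le> P * Q" "real (x p') * y q \<le> P * Q"
          using bx pos by (auto intro!: mult_mono)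
        moreover have "0 \<le> real (x p) * y q'" "0 \<le> real (x p') * y q" by auto
        ultimately have "\<bar>real (x p) * y q' - real (x p') * y q\<bar> \<le> P * Q"
          by linarith
        also have "\<dots> = 1 * (P * Q) * 1" by simp
        also have "\<dots> \<le> D\<^sup>2 * (P * Q) * (2 * (c * F) / Y)"
          using Y pos by (intro mult_mono one_le_power) (auto simp: field_simps)
        finally show ?thesis by (simp add: B_def mult_ac)
      next
        case 2
        then have r: "p = q + m" "p' = q' + m'"
          using rel[OF t(1)] rel[OF t(2)] by (auto simp: summand_relation_def)
        have "\<bar>real (x p) * y q' - real (x p') * y q\<bar> \<le> D ^ (k - 1) * P * Q * (c * F) / (Y / 2)"
        proof (rule abs_det_le[where a = a and b = b and m = m and m' = m'])
          show "real a * real (x p) ^ k = real b * real (y q) ^ k + real m"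
            "real a * real (x p') ^ k = real b * real (y q') ^ k + real m'"
            using real_fac r by (metis of_nat_add)+
          have "Max {p, q, m} = p" using r by (simp add: max_def)
          then show "Y / 2 \<le> real a * real (x p) ^ k"
            using size[OF t(1)] real_fac by simp
        qed (use a k0 xy[OF t(1)] xy[OF t(2)] bx fc pos in auto)
        then show ?thesis using Bk by linarith
      next
        case 3
        \<comment> \<open>Now \<open>q\<close> is the largest entry, so \<open>abs_det_le\<close> is
          applied with the roles of \<open>p\<close> and \<open>q\<close> exchanged.\<close>
        then have r: "q = p + m" "q' = p' + m'"
          using rel[OF t(1)] rel[OF t(2)] by (auto simp: summand_relation_def)
        have "\<bar>real (y q) * x p' - real (y q') * x p\<bar> \<le> D ^ (k - 1) * Q * P * (c * F) / (Y / 2)"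
        proof (rule abs_det_le[where a = b and b = a and m = m and m' = m'])
          show "real b * real (y q) ^ k = real a * real (x p) ^ k + real m"
            "real b * real (y q') ^ k = real a * real (x p') ^ k + real m'"
            using real_fac r by (metis of_nat_add)+
          have "Max {p, q, m} = q" using r by (simp add: max_def)
          then show "Y / 2 \<le> real b * real (y q) ^ k"
            using size[OF t(1)] real_fac by simp
        qed (use b k0 xy[OF t(1)] xy[OF t(2)] bx fc pos in auto)
        then show ?thesis using Bk by (simp add: mult_ac abs_minus_commute)
      qed
    qed
    then show "\<bar>real_of_int (u * v' - u' * v)\<bar> \<le> B"
      by (simp add: uv)
  next
    fix u v :: int assume "(u, v) \<in> g ` W"
    then obtain p q m where t: "(p, q, m) \<in> W" and uv: "u = int (x p)" "v = int (y q)"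
      by (auto simp: g_def)
    show "coprime u (int c) \<and> coprime v (int c) \<and> coprime u v"
      using copc[OF t] by (simp add: uv)
    show "P / D \<le> u \<and> u \<le> P"
      using box[OF t] by (simp add: uv)
  qed (use assms cF in \<open>auto simp: B_def\<close>)
  also have "18 * D\<^sup>2 * B / c = 36 * D ^ 4 * (P * Q * F) / Y"
    using c by (simp add: B_def power2_eq_square power4_eq_xxxx)
  finally show ?thesis
    using card_image[OF inj] by simp
qed

text \<open>Sums the fibre bound over all cofactors. By \<open>N\<close> they number at most
  \<open>N * RA\<close>, \<open>N * RB\<close>, \<open>N * RC\<close>; the factor 3 counts the
  relations.\<close>

lemma card_factored_le:
  fixes W :: "(nat \<times> nat \<times> nat) set" and x y A B C :: "nat \<Rightarrow> nat" and P Q F D Y M N RA RB RC :: real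
  assumes k: "k \<in> {1, 2, 3}" and "finite W" and pos: "1 \<le> D" "0 < P" "0 < Q" "0 \<le> F" "0 < Y"
    and rel: "\<And>t. t \<in> W \<Longrightarrow> \<exists>j<3. summand_relation j t"
    and cop: "\<And>p q m. (p, q, m) \<in> W \<Longrightarrow> 0 < p \<and> 0 < q \<and> 0 < m \<and> coprime p q"
    and size: "\<And>p q m. (p, q, m) \<in> W \<Longrightarrow> Y / 2 \<le> real (Max {p, q, m}) \<and> real (Max {p, q, m}) \<le> Y"
    and fac: "\<And>p q m. (p, q, m) \<in> W \<Longrightarrow>
      p = A p * x p ^ k \<and> q = B q * y q ^ k \<and> C m dvd m \<and> m \<le> C m * F"
    and box: "\<And>p q m. (p, q, m) \<in> W \<Longrightarrow> P / D \<le> x p \<and> x p \<le> P \<and> Q / D \<le> y q \<and> y q \<le> Q"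
    and rads: "\<And>p q m. (p, q, m) \<in> W \<Longrightarrow> real (rad (A p)) \<le> RA \<and> real (rad (B q)) \<le> RB \<and> real (rad (C m)) \<le> RC"
    and R: "0 \<le> RA" "0 \<le> RB" "0 \<le> RC"
    and N: "\<And>R. 0 \<le> R \<Longrightarrow> finite {n::nat. 0 < n \<and> real n \<le> Y \<and> real (rad n) \<le> R} \<and>
      real (card {n::nat. 0 < n \<and> real n \<le> Y \<and> real (rad n) \<le> R}) \<le> N * R"
    and M: "\<And>n::nat. 0 < n \<Longrightarrow> real n \<le> Y \<Longrightarrow> real (card {d. d dvd n}) \<le> M"
  shows "real (card W) \<le> 3 * N ^ 3 * (RA * RB * RC) * (M\<^sup>2 * (1 + 36 * D ^ 4 * (P * Q * F) / Y))"
proof -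
  define S where "S = (\<lambda>R::real. {n::nat. 0 < n \<and> real n \<le> Y \<and> real (rad n) \<le> R})"
  let ?b = "M\<^sup>2 * (1 + 36 * D ^ 4 * (P * Q * F) / Y)"
  have S: "finite (S R)" "real (card (S R)) \<le> N * R" if "0 \<le> R" for R
    using N[OF that] by (auto simp: S_def)
  have NR: "0 \<le> N * R" if "0 \<le> R" for R
    using S(2)[OF that] of_nat_0_le_iff order_trans by blast
  define I where "I = S RA \<times> S RB \<times> S RC \<times> {..<3::nat}"
  define G where "G = (\<lambda>(a, b, c, j). {(p, q, m). (p, q, m) \<in> W \<and> A p = a \<and> B q = b \<and> C m = c \<and>
    summand_relation j (p, q, m)})"
  have finI: "finite I" using S R by (auto simp: I_def)
  have sub: "W \<subseteq> (\<Union>i\<in>I. G i)"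
  proof
    fix t assume t: "t \<in> W"
    obtain p q m where eq: "t = (p, q, m)" by (metis surj_pair)
    note t' = t[unfolded eq]
    obtain j where j: "j < 3" "summand_relation j t" using rel[OF t] by blast
    have "A p dvd p" "B q dvd q" "C m dvd m" "0 < p" "0 < q" "0 < m"
      using fac[OF t'] cop[OF t'] by (auto intro: dvdI)
    then have "0 < A p" "0 < B q" "0 < C m" "A p \<le> p" "B q \<le> q" "C m \<le> m"
      by (auto intro!: dvd_imp_le Nat.gr0I)
    moreover have "real p \<le> Y" "real q \<le> Y" "real m \<le> Y"
      using size[OF t'] by auto
    ultimately have "A p \<in> S RA" "B q \<in> S RB" "C m \<in> S RC"
      using rads[OF t'] by (auto simp: S_def)
    then have "(A p, B q, C m, j) \<in> I" "t \<in> G (A p, B q, C m, j)"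
      using j t by (auto simp: I_def G_def eq)
    then show "t \<in> (\<Union>i\<in>I. G i)" by blast
  qed
  have subG: "G i \<subseteq> W" for i
    by (auto simp: G_def split: prod.splits)
  then have finG: "finite (G i)" for i
    using assms(2) finite_subset by blast
  have "real (card W) \<le> real (card (\<Union>i\<in>I. G i))"
    using finI finG card_mono[OF _ sub] by simp
  also have "\<dots> \<le> real (card I) * ?b"
  proof (rule card_UN_le_mult[OF finI])
    fix i assume "i \<in> I"
    then obtain a b c j where i: "i = (a, b, c, j)" "c \<in> S RC"
      by (auto simp: I_def)
    have G: "(p, q, m) \<in> W" "A p = a" "B q = b" "C m = c" if "(p, q, m) \<in> G i" for p q m
      using that by (auto simp: G_def i)
    show "real (card (G i)) \<le> ?b"
    proof (rule card_fibre_le[OF k finG pos, of _ j a x b y c])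
      show "summand_relation j t" if "t \<in> G i" for t
        using that by (auto simp: G_def i)
      show "0 < p \<and> 0 < q \<and> 0 < m \<and> coprime p q" if "(p, q, m) \<in> G i" for p q m
        using cop[OF G(1)[OF that]] .
      show "Y / 2 \<le> real (Max {p, q, m})" if "(p, q, m) \<in> G i" for p q m
        using size[OF G(1)[OF that]] by blast
      show "p = a * x p ^ k \<and> q = b * y q ^ k \<and> c dvd m \<and> real m \<le> c * F" if "(p, q, m) \<in> G i" for p q m
        using fac[OF G(1)[OF that]] G[OF that] by metis
      show "P / D \<le> x p \<and> x p \<le> P \<and> Q / D \<le> y q \<and> y q \<le> Q" if "(p, q, m) \<in> G i" for p q m
        using box[OF G(1)[OF that]] .
      show "real (card {d. d dvd c}) \<le> M"
        using M i(2) by (simp add: S_def)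
    qed
  qed
  also have "real (card I) = real (card (S RA)) * real (card (S RB)) * real (card (S RC)) * 3"
    by (simp add: I_def card_cartesian_product)
  also have "\<dots> * ?b \<le> (N * RA) * (N * RB) * (N * RC) * 3 * ?b"
    using S R NR pos by (intro mult_right_mono mult_mono mult_nonneg_nonneg[OF NR NR]) auto
  finally show ?thesis
    by (simp add: power3_eq_cube mult_ac)
qed

section \<open>Splitting an integer by exponents\<close>

text \<open>Class 5 collects all exponents \<open>\<ge> 5\<close>; these primes always stay in the cofactor.\<close>

definition exponent_class :: "nat \<Rightarrow> nat \<Rightarrow> nat" where
  "exponent_class n p = min (multiplicity p n) 5"

definition exponent_part :: "nat \<Rightarrow> nat \<Rightarrow> nat" where
  "exponent_part n i = (\<Prod>p\<in>{p \<in> prime_factors n. exponent_class n p = i}. p)"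

text \<open>This is a true \<open>k\<close>-th root of the part of \<open>n\<close> in the classes
  \<open>S\<close> only when \<open>k\<close> divides the exponents that occur; otherwise the
  division rounds down.\<close>

definition class_root :: "nat \<Rightarrow> nat set \<Rightarrow> nat \<Rightarrow> nat" where
  "class_root k S n = (\<Prod>p\<in>{p \<in> prime_factors n. exponent_class n p \<in> S}. p ^ (multiplicity p n div k))"

text \<open>Taking \<open>k = 1\<close> on the complement keeps full prime powers. For
  \<open>S\<close> inside \<open>{1..4}\<close> the complement contains class 5.\<close>

definition class_cofactor :: "nat set \<Rightarrow> nat \<Rightarrow> nat" where
  "class_cofactor S n = class_root 1 (- S) n"

lemma part_pos: "0 < exponent_part n i"
  by (auto simp: exponent_part_def in_prime_factors_iff prime_gt_0_nat intro!: prod_pos)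

lemma exponent_class_le: "p \<in> prime_factors n \<Longrightarrow> exponent_class n p \<in> {1..5}"
  by (auto simp: exponent_class_def prime_factors_multiplicity)

lemma class_factorization:
  assumes "0 < n" "S \<subseteq> {1..4}" "\<forall>i\<in>S. k dvd i"
  shows "n = class_cofactor S n * class_root k S n ^ k"
proof -
  have "class_root k S n ^ k = (\<Prod>p\<in>{p \<in> prime_factors n. exponent_class n p \<in> S}. p ^ multiplicity p n)"
    unfolding class_root_def prod_power_distrib
  proof (intro prod.cong refl)
    fix p assume p: "p \<in> {p \<in> prime_factors n. exponent_class n p \<in> S}"
    \<comment> \<open>The cap at 5 is not reached, as \<open>S\<close> avoids class 5.\<close>
    then have "multiplicity p n = exponent_class n p"
      using assms(2) by (auto simp: exponent_class_def min_def split: if_splits)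
    then have "k dvd multiplicity p n"
      using assms(3) p by auto
    then show "(p ^ (multiplicity p n div k)) ^ k = p ^ multiplicity p n"
      by (simp flip: power_mult)
  qed
  moreover have "class_cofactor S n =
      (\<Prod>p\<in>{p \<in> prime_factors n. exponent_class n p \<notin> S}. p ^ multiplicity p n)"
    by (simp add: class_cofactor_def class_root_def)
  moreover have "prime_factors n = {p \<in> prime_factors n. exponent_class n p \<notin> S} \<union>
      {p \<in> prime_factors n. exponent_class n p \<in> S}"
    by auto
  then have "(\<Prod>p\<in>prime_factors n. p ^ multiplicity p n) =
      (\<Prod>p\<in>{p \<in> prime_factors n. exponent_class n p \<notin> S}. p ^ multiplicity p n) *
      (\<Prod>p\<in>{p \<in> prime_factors n. exponent_class n p \<in> S}. p ^ multiplicity p n)"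
    by (subst prod.union_disjoint[symmetric]) auto
  ultimately show ?thesis
    using prime_factorization_nat[OF assms(1)] by simp
qed

lemma class_root_eq:
  assumes "S \<subseteq> {1..4}"
  shows "class_root k S n = (\<Prod>i\<in>S. exponent_part n i ^ (i div k))"
proof -
  let ?A = "{p \<in> prime_factors n. exponent_class n p \<in> S}"
  have fin: "finite S" using assms finite_subset by blast
  have "class_root k S n = (\<Prod>i\<in>S. \<Prod>p\<in>{p \<in> ?A. exponent_class n p = i}. p ^ (multiplicity p n div k))"
    unfolding class_root_def using fin by (subst prod.group) auto
  also have "\<dots> = (\<Prod>i\<in>S. exponent_part n i ^ (i div k))"
  proof (intro prod.cong refl)
    fix i assume i: "i \<in> S"
    then have "i \<le> 4" using assms by auto
    have "(\<Prod>p\<in>{p \<in> ?A. exponent_class n p = i}. p ^ (multiplicity p n div k)) =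
        (\<Prod>p\<in>{p \<in> prime_factors n. exponent_class n p = i}. p ^ (i div k))"
      using i \<open>i \<le> 4\<close>
      by (intro prod.cong) (auto simp: exponent_class_def min_def split: if_splits)
    then show "(\<Prod>p\<in>{p \<in> ?A. exponent_class n p = i}. p ^ (multiplicity p n div k)) =
        exponent_part n i ^ (i div k)"
      by (simp add: exponent_part_def prod_power_distrib)
  qed
  finally show ?thesis .
qed

lemma rad_class_cofactor: "rad (class_cofactor S n) = (\<Prod>i\<in>{1..5} - S. exponent_part n i)"
proof -
  let ?A = "{p \<in> prime_factors n. exponent_class n p \<notin> S}"
  have A: "finite ?A" "\<forall>p\<in>?A. prime p \<and> 0 < multiplicity p n"
    by (simp, auto simp: prime_factors_multiplicity)
  have "prime_factors (class_cofactor S n) = ?A"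
    using prime_factors_prod_prime_powers[OF A] by (simp add: class_cofactor_def class_root_def)
  then have "rad (class_cofactor S n) = \<Prod>?A"
    by (simp add: rad_def)
  also have "\<dots> = (\<Prod>i\<in>{1..5} - S. \<Prod>{p \<in> ?A. exponent_class n p = i})"
    using exponent_class_le by (subst prod.group) auto
  also have "\<dots> = (\<Prod>i\<in>{1..5} - S. exponent_part n i)"
    unfolding exponent_part_def by (intro prod.cong refl) auto
  finally show ?thesis .
qed

lemma rad_eq_prod_part: "0 < n \<Longrightarrow> rad n = (\<Prod>i\<in>{1..5}. exponent_part n i)"
  using rad_class_cofactor[of "{}" n] class_factorization[of n "{}" 1]
  by (simp add: class_root_def)

text \<open>Only an inequality: primes of class 5 are counted with exponent 5 instead of their
  multiplicity.\<close>

lemma prod_part_power_le: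
  assumes "0 < n"
  shows "(\<Prod>i\<in>{1..5}. exponent_part n i ^ i) \<le> n"
proof -
  have "(\<Prod>i\<in>{1..5}. exponent_part n i ^ i) =
      (\<Prod>i\<in>{1..5}. \<Prod>p\<in>{p \<in> prime_factors n. exponent_class n p = i}. p ^ exponent_class n p)"
    unfolding exponent_part_def prod_power_distrib by (intro prod.cong refl) auto
  also have "\<dots> = (\<Prod>p\<in>prime_factors n. p ^ exponent_class n p)"
    using exponent_class_le by (subst prod.group) auto
  also have "\<dots> \<le> (\<Prod>p\<in>prime_factors n. p ^ multiplicity p n)"
    by (intro prod_mono)
      (auto simp: exponent_class_def in_prime_factors_iff prime_gt_0_nat Suc_leI intro!: power_increasing)
  also have "\<dots> = n"
    using prime_factorization_nat[OF assms] by simp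
  finally show ?thesis .
qed

lemma rad_mult_coprime:
  assumes "coprime a b" "0 < a" "0 < (b::nat)"
  shows "rad (a * b) = rad a * rad b"
proof -
  have "prime_factors a \<inter> prime_factors b = {}"
    using assms(1) by (auto simp: in_prime_factors_iff) (metis coprime_common_divisor_nat not_prime_1)
  then show ?thesis
    using assms unfolding rad_def by (simp add: prime_factors_product prod.union_disjoint)
qed

lemma part_le:
  assumes "0 < n" "i \<in> {1..5}"
  shows "exponent_part n i \<le> n"
proof -
  have "exponent_part n i dvd rad n"
    unfolding rad_eq_prod_part[OF assms(1)] using assms(2) by (intro dvd_prodI) auto
  then show ?thesis
    using rad_dvd[OF assms(1)] assms(1) by (meson dvd_imp_le dvd_trans)
qed

section \<open>Logarithmic coordinates to the base Y\<close>

definition log_part :: "real \<Rightarrow> nat \<Rightarrow> nat \<Rightarrow> real" where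
  "log_part Y n i = log Y (exponent_part n i)"

context
  fixes Y :: real
  assumes Y: "1 < Y"
begin

lemma log_part_nonneg: "0 \<le> log_part Y n i"
  using part_pos[of n i] Y by (simp add: log_part_def Suc_leI)

lemma part_eq_powr: "real (exponent_part n i) = Y powr log_part Y n i"
  using part_pos[of n i] Y by (simp add: log_part_def)

lemma powr_sum: "Y powr (\<Sum>i\<in>I. f i) = (\<Prod>i\<in>I. Y powr f i)"
  using Y by (induction I rule: infinite_finite_induct) (simp_all add: powr_add)

lemma class_root_eq_powr:
  assumes "S \<subseteq> {1..4}" "\<forall>i\<in>S. k dvd i" "0 < k"
  shows "real (class_root k S n) = Y powr ((\<Sum>i\<in>S. i * log_part Y n i) / k)"
proof -
  have "real (class_root k S n) = (\<Prod>i\<in>S. (Y powr log_part Y n i) ^ (i div k))"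
    unfolding class_root_eq[OF assms(1)] by (simp add: part_eq_powr)
  also have "\<dots> = (\<Prod>i\<in>S. Y powr (i * log_part Y n i / k))"
  proof (intro prod.cong refl)
    fix i assume "i \<in> S"
    then have "real (i div k) = i / k"
      using assms by (simp add: real_of_nat_div)
    then show "(Y powr log_part Y n i) ^ (i div k) = Y powr (i * log_part Y n i / k)"
      using Y by (simp add: powr_realpow[symmetric] powr_powr mult.commute)
  qed
  finally show ?thesis
    by (simp add: powr_sum sum_divide_distrib)
qed

lemma rad_class_cofactor_eq_powr:
  "real (rad (class_cofactor S n)) = Y powr (\<Sum>i\<in>{1..5} - S. log_part Y n i)"
  by (simp add: rad_class_cofactor part_eq_powr powr_sum)

lemma rad_eq_powr: "0 < n \<Longrightarrow> real (rad n) = Y powr (\<Sum>i\<in>{1..5}. log_part Y n i)"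
  by (simp add: rad_eq_prod_part part_eq_powr powr_sum)

text \<open>Supplies the constraint \<open>V\<close> of the linear program.\<close>

lemma sum_log_part_le:
  assumes "0 < n" "real n \<le> Y"
  shows "(\<Sum>i\<in>{1..5}. i * log_part Y n i) \<le> 1"
proof -
  have "Y powr (\<Sum>i\<in>{1..5}. i * log_part Y n i) = (\<Prod>i\<in>{1..5}. real (exponent_part n i) ^ i)"
    unfolding powr_sum part_eq_powr using Y
    by (intro prod.cong refl) (simp add: powr_realpow[symmetric] powr_powr mult.commute)
  also have "\<dots> = real (\<Prod>i\<in>{1..5}. exponent_part n i ^ i)"
    by simp
  also have "\<dots> \<le> real n"
    using prod_part_power_le[OF assms(1)] by (simp only: of_nat_le_iff)
  also have "\<dots> \<le> Y powr 1"
    using assms(2) Y by simp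
  finally show ?thesis
    by (simp only: powr_le_cancel_iff[OF Y])
qed

lemma log_part_le_1:
  assumes "0 < n" "real n \<le> Y" "i \<in> {1..5}"
  shows "log_part Y n i \<le> 1"
proof -
  have "real (exponent_part n i) \<le> Y"
    using part_le[OF assms(1,3)] assms(2) by linarith
  then show ?thesis
    using Y part_pos[of n i] by (simp add: log_part_def)
qed

end

section \<open>Triples in a box\<close>

text \<open>A version of the triples that is closed under permutations, so that each entry can serve
  as the modulus.\<close>

definition sum_triples :: "real \<Rightarrow> (nat \<times> nat \<times> nat) set" where
  "sum_triples Y = {(p, q, m). 0 < p \<and> 0 < q \<and> 0 < m \<and> coprime p q \<and>
     (p + q = m \<or> q + m = p \<or> p + m = q) \<and> Y / 2 \<le> real (Max {p, q, m}) \<and> real (Max {p, q, m}) \<le> Y}"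

definition same_size :: "real \<Rightarrow> real \<Rightarrow> nat \<Rightarrow> nat \<Rightarrow> bool" where
  "same_size \<delta> Y n n0 \<longleftrightarrow> (\<forall>i\<in>{1..5}. \<bar>log_part Y n i - log_part Y n0 i\<bar> \<le> \<delta>)"

text \<open>For logarithmic parts of a positive integer, this is the logarithm of its
  radical.\<close>

definition mass :: "(nat \<Rightarrow> real) \<Rightarrow> real" where
  "mass a = (\<Sum>i\<in>{1..5}. a i)"

lemma sum_same_size:
  assumes "same_size \<delta> Y n n0" "S \<subseteq> {1..5}" "\<And>i. i \<in> S \<Longrightarrow> 0 \<le> w i" "(\<Sum>i\<in>S. w i) \<le> c" "0 \<le> \<delta>"
  shows "\<bar>(\<Sum>i\<in>S. w i * log_part Y n i) - (\<Sum>i\<in>S. w i * log_part Y n0 i)\<bar> \<le> c * \<delta>"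
proof -
  have "\<bar>(\<Sum>i\<in>S. w i * log_part Y n i) - (\<Sum>i\<in>S. w i * log_part Y n0 i)\<bar> =
      \<bar>\<Sum>i\<in>S. w i * (log_part Y n i - log_part Y n0 i)\<bar>"
    by (simp add: sum_subtractf right_diff_distrib)
  also have "\<dots> \<le> (\<Sum>i\<in>S. \<bar>w i * (log_part Y n i - log_part Y n0 i)\<bar>)"
    by (rule sum_abs)
  also have "\<dots> \<le> (\<Sum>i\<in>S. w i * \<delta>)"
    using assms by (intro sum_mono) (auto simp: abs_mult same_size_def intro!: mult_left_mono)
  also have "\<dots> \<le> c * \<delta>"
    using assms(4,5) by (simp add: sum_distrib_right[symmetric] mult_right_mono)
  finally show ?thesis .
qed

text \<open>Source of the error terms \<open>15 * \<delta>\<close> for roots (15 = 1 + 2 + 3 + 4 +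
  5) and \<open>5 * \<delta>\<close> for radicals.\<close>

lemma class_weights_le:
  assumes "S \<subseteq> {1..5::nat}"
  shows "(\<Sum>i\<in>S. real i) \<le> 15" "(\<Sum>i\<in>S. (1::real)) \<le> 5"
proof -
  have "(\<Sum>i\<in>S. real i) \<le> (\<Sum>i\<in>{1..5}. real i)"
    using assms by (intro sum_mono2) auto
  then show "(\<Sum>i\<in>S. real i) \<le> 15" by (simp add: numeral_eq_Suc)
  have "(\<Sum>i\<in>S. (1::real)) \<le> (\<Sum>i\<in>{1..5::nat}. 1)"
    using assms by (intro sum_mono2) auto
  then show "(\<Sum>i\<in>S. (1::real)) \<le> 5" by simp
qed

lemma sum_triples_relation:
  assumes "t \<in> sum_triples Y"
  shows "\<exists>j<3. summand_relation j t"
proof -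
  have "summand_relation 0 t \<or> summand_relation 1 t \<or> summand_relation 2 t"
    using assms by (auto simp: sum_triples_def summand_relation_def)
  then show ?thesis
    by (elim disjE) (rule exI, rule conjI[rotated], assumption, simp)+
qed

context
  fixes \<delta> Y K L :: real and W :: "(nat \<times> nat \<times> nat) set" and p0 q0 m0 :: nat
  assumes Y: "1 < Y" and \<delta>: "0 < \<delta>"
    and K: "1 \<le> K" "\<And>R. 0 \<le> R \<Longrightarrow> finite {n::nat. 0 < n \<and> real n \<le> Y \<and> real (rad n) \<le> R} \<and>
      real (card {n::nat. 0 < n \<and> real n \<le> Y \<and> real (rad n) \<le> R}) \<le> K * Y powr \<delta> * R"
    and L: "1 \<le> L" "\<And>n::nat. 0 < n \<Longrightarrow> real n \<le> Y \<Longrightarrow> real (card {d. d dvd n}) \<le> L * Y powr \<delta>"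
    and W: "finite W" "W \<subseteq> sum_triples Y"
    and box: "\<And>p q m. (p, q, m) \<in> W \<Longrightarrow> same_size \<delta> Y p p0 \<and> same_size \<delta> Y q q0 \<and> same_size \<delta> Y m m0"
begin

lemma rad_class_cofactor_le:
  assumes "same_size \<delta> Y n n0"
  shows "real (rad (class_cofactor S n)) \<le> Y powr ((\<Sum>i\<in>{1..5} - S. log_part Y n0 i) + 5 * \<delta>)"
proof -
  have "{1..5} - S \<subseteq> {1..5::nat}" by auto
  then show ?thesis
    using sum_same_size[OF assms, of "{1..5} - S" "\<lambda>_. 1" 5] class_weights_le(2)[of "{1..5} - S"] \<delta> Y
    by (simp add: rad_class_cofactor_eq_powr[OF Y])
qed

text \<open>The root moves by at most \<open>15 * \<delta>\<close> in either direction on the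
  logarithmic scale; the window has ratio \<open>Y powr (30 * \<delta>)\<close>, which becomes
  \<open>D\<close>.\<close>

lemma class_root_bounds:
  assumes "same_size \<delta> Y n n0" "S \<subseteq> {1..4}" "\<forall>i\<in>S. k dvd i" "0 < k"
  shows "Y powr ((\<Sum>i\<in>S. i * log_part Y n0 i) / k + 15 * \<delta>) / Y powr (30 * \<delta>) \<le> class_root k S n"
    and "class_root k S n \<le> Y powr ((\<Sum>i\<in>S. i * log_part Y n0 i) / k + 15 * \<delta>)"
proof -
  let ?s = "\<lambda>n. \<Sum>i\<in>S. real i * log_part Y n i"
  have S: "S \<subseteq> {1..5}" using assms(2) by auto
  have "\<bar>?s n - ?s n0\<bar> \<le> 15 * \<delta>"
    using sum_same_size[OF assms(1) S, of real 15] class_weights_le(1)[OF S] \<delta> by simp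
  then have "\<bar>?s n - ?s n0\<bar> / k \<le> 15 * \<delta> / 1"
    using assms(4) \<delta> by (intro frac_le) auto
  then have "\<bar>?s n / k - ?s n0 / k\<bar> \<le> 15 * \<delta>"
    by (simp add: diff_divide_distrib[symmetric] abs_divide)
  then show "Y powr (?s n0 / k + 15 * \<delta>) / Y powr (30 * \<delta>) \<le> class_root k S n"
    "class_root k S n \<le> Y powr (?s n0 / k + 15 * \<delta>)"
    using Y by (auto simp: class_root_eq_powr[OF Y assms(2-4)] powr_diff[symmetric])
qed

lemma sum_triples_facts:
  assumes "(p, q, m) \<in> W"
  shows "0 < p \<and> 0 < q \<and> 0 < m \<and> coprime p q"
    "Y / 2 \<le> real (Max {p, q, m}) \<and> real (Max {p, q, m}) \<le> Y"
  using assms W(2) by (auto simp: sum_triples_def)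

lemma card_box_le_strategy:
  assumes "strategy (log_part Y p0) (log_part Y q0) (log_part Y m0) g"
  shows "real (card W) \<le> 111 * K ^ 3 * L\<^sup>2 *
    Y powr (mass (log_part Y p0) + mass (log_part Y q0) + mass (log_part Y m0) - g + 200 * \<delta>)"
proof -
  let ?a = "log_part Y p0" and ?b = "log_part Y q0" and ?c = "log_part Y m0"
  obtain k S T R where k: "k \<in> {1, 2, 3}" and sub: "S \<subseteq> {1..4}" "T \<subseteq> {1..4}" "R \<subseteq> {1..4}"
    and dvd: "\<forall>i\<in>S \<union> T. k dvd i" and g1: "g \<le> sum ?a S + sum ?b T + sum ?c R"
    and g2: "g + ((\<Sum>i\<in>S. real i * ?a i) + (\<Sum>i\<in>T. real i * ?b i)) / real k + (\<Sum>i\<in>R. real i * ?c i)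
       \<le> sum ?a S + sum ?b T + sum ?c R + 1"
    using assms unfolding strategy_def by blast
  have k0: "0 < k" using k by auto
  have dvds: "\<forall>i\<in>S. k dvd i" "\<forall>i\<in>T. k dvd i" "\<forall>i\<in>R. 1 dvd i" using dvd by auto
  define P where "P = Y powr ((\<Sum>i\<in>S. i * ?a i) / k + 15 * \<delta>)"
  define Q where "Q = Y powr ((\<Sum>i\<in>T. i * ?b i) / k + 15 * \<delta>)"
  define F where "F = Y powr ((\<Sum>i\<in>R. i * ?c i) / (1::nat) + 15 * \<delta>)"
  define D where "D = Y powr (30 * \<delta>)"
  define RA where "RA = Y powr ((\<Sum>i\<in>{1..5} - S. ?a i) + 5 * \<delta>)"
  define RB where "RB = Y powr ((\<Sum>i\<in>{1..5} - T. ?b i) + 5 * \<delta>)"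
  define RC where "RC = Y powr ((\<Sum>i\<in>{1..5} - R. ?c i) + 5 * \<delta>)"
  have main: "real (card W) \<le> 3 * (K * Y powr \<delta>) ^ 3 * (RA * RB * RC) *
      ((L * Y powr \<delta>)\<^sup>2 * (1 + 36 * D ^ 4 * (P * Q * F) / Y))"
  proof (rule card_factored_le[OF k W(1), where x = "class_root k S" and y = "class_root k T"
        and A = "class_cofactor S" and B = "class_cofactor T" and C = "class_cofactor R"])
    show "1 \<le> D" using Y \<delta> by (simp add: D_def ge_one_powr_ge_zero)
    fix p q m assume t: "(p, q, m) \<in> W"
    note f = sum_triples_facts[OF t] and b = box[OF t]
    have "m = class_cofactor R m * class_root 1 R m"
      using class_factorization[of m R 1] f sub(3) by simp
    moreover have "real (class_cofactor R m * class_root 1 R m) \<le> class_cofactor R m * F"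
      using class_root_bounds(2)[of m m0 R 1] b sub by (simp add: F_def mult_left_mono)
    ultimately show "p = class_cofactor S p * class_root k S p ^ k \<and>
        q = class_cofactor T q * class_root k T q ^ k \<and> class_cofactor R m dvd m \<and>
        real m \<le> real (class_cofactor R m) * F"
      using class_factorization[of p S k] class_factorization[of q T k] f sub dvds
      by (metis dvd_triv_left)
    show "P / D \<le> class_root k S p \<and> class_root k S p \<le> P \<and>
        Q / D \<le> class_root k T q \<and> class_root k T q \<le> Q"
      using class_root_bounds[of p p0 S k] class_root_bounds[of q q0 T k] b sub dvds k0
      by (simp add: P_def Q_def D_def)
    show "real (rad (class_cofactor S p)) \<le> RA \<and> real (rad (class_cofactor T q)) \<le> RB \<and>
        real (rad (class_cofactor R m)) \<le> RC"
      using rad_class_cofactor_le b by (simp add: RA_def RB_def RC_def)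
  qed (use sum_triples_facts sum_triples_relation[OF subsetD[OF W(2)]] Y K(2) L(2) in
      \<open>auto simp: P_def Q_def F_def RA_def RB_def RC_def\<close>)
  have split: "(\<Sum>i\<in>{1..5} - S. f i) = mass f - sum f S" if "S \<subseteq> {1..4}" for f :: "nat \<Rightarrow> real" and S
    using that unfolding mass_def by (intro sum_diff) auto
  define \<mu> where "\<mu> = mass ?a + mass ?b + mass ?c"
  define w where "w = sum ?a S + sum ?b T + sum ?c R"
  define v where "v = ((\<Sum>i\<in>S. real i * ?a i) + (\<Sum>i\<in>T. real i * ?b i)) / real k + (\<Sum>i\<in>R. real i * ?c i)"
  have gw: "g \<le> w" "g + v \<le> w + 1" using g1 g2 by (auto simp: w_def v_def)
  have R3: "RA * RB * RC = Y powr (\<mu> - w + 15 * \<delta>)"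
    unfolding RA_def RB_def RC_def powr_add[symmetric] split[OF sub(1)] split[OF sub(2)] split[OF sub(3)]
    by (simp add: \<mu>_def w_def algebra_simps)
  have "D ^ 4 = Y powr (120 * \<delta>)"
    using Y by (simp add: D_def powr_realpow[symmetric] powr_powr)
  moreover have "P * Q * F = Y powr (v + 45 * \<delta>)"
    unfolding P_def Q_def F_def powr_add[symmetric] by (simp add: v_def add_divide_distrib algebra_simps)
  ultimately have "D ^ 4 * (P * Q * F) / Y = Y powr (v + 165 * \<delta> - 1)"
    using Y by (simp add: powr_diff powr_add[symmetric] algebra_simps)
  then have PQ: "36 * D ^ 4 * (P * Q * F) / Y = 36 * Y powr (v + 165 * \<delta> - 1)"
    by simp
  have K3: "3 * (K * Y powr \<delta>) ^ 3 = 3 * K ^ 3 * Y powr (3 * \<delta>)"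
    using Y by (simp add: power_mult_distrib powr_realpow[symmetric] powr_powr mult.commute)
  have L2: "(L * Y powr \<delta>)\<^sup>2 = L\<^sup>2 * Y powr (2 * \<delta>)"
    using Y by (simp add: power_mult_distrib powr_realpow[symmetric] powr_powr mult.commute)
  have "3 * (K * Y powr \<delta>) ^ 3 * (RA * RB * RC) * ((L * Y powr \<delta>)\<^sup>2 * (1 + 36 * D ^ 4 * (P * Q * F) / Y)) =
      3 * K ^ 3 * L\<^sup>2 * (Y powr (3 * \<delta>) * Y powr (\<mu> - w + 15 * \<delta>) * Y powr (2 * \<delta>) * 1 +
        36 * (Y powr (3 * \<delta>) * Y powr (\<mu> - w + 15 * \<delta>) * Y powr (2 * \<delta>) * Y powr (v + 165 * \<delta> - 1)))"
    unfolding K3 L2 R3 PQ by (simp only: algebra_simps)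
  \<comment> \<open>The losses are 3 + 15 + 2 = 20 times \<delta> from the counts of cofactors and
    classes, and 120 + 45 = 165 more in the second term from \<open>D ^ 4\<close> and
    \<open>P * Q * F\<close>.\<close>
  also have "\<dots> = 3 * K ^ 3 * L\<^sup>2 * (Y powr (\<mu> - w + 20 * \<delta>) + 36 * Y powr (\<mu> - w + v - 1 + 185 * \<delta>))"
    by (simp add: powr_add[symmetric] algebra_simps)
  \<comment> \<open>The two inequalities of \<open>strategy\<close> bound one term each, and 185 is
    rounded up to 200. Then 111 = 3 * (1 + 36).\<close>
  also have "\<dots> \<le> 3 * K ^ 3 * L\<^sup>2 * (Y powr (\<mu> - g + 200 * \<delta>) + 36 * Y powr (\<mu> - g + 200 * \<delta>))"
    using gw \<delta> Y K(1) L(1) by (intro mult_left_mono add_mono) auto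
  also have "\<dots> = 111 * K ^ 3 * L\<^sup>2 * Y powr (\<mu> - g + 200 * \<delta>)"
    by simp
  finally show ?thesis
    unfolding \<mu>_def by (rule order_trans[OF main])
qed

text \<open>The entries \<open>p\<close> and \<open>q\<close> leave at most three values of
  \<open>m\<close>, so its mass is saved. This is the degenerate factorization with cofactors
  \<open>p\<close>, \<open>q\<close>, \<open>1\<close> and \<open>F = Y\<close>.\<close>

lemma card_box_le_trivial:
  assumes "g \<le> mass (log_part Y m0)"
  shows "real (card W) \<le> 111 * K ^ 3 * L\<^sup>2 *
    Y powr (mass (log_part Y p0) + mass (log_part Y q0) + mass (log_part Y m0) - g + 200 * \<delta>)"
proof -
  let ?a = "log_part Y p0" and ?b = "log_part Y q0" and ?c = "log_part Y m0"
  define RA where "RA = Y powr (mass ?a + 5 * \<delta>)"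
  define RB where "RB = Y powr (mass ?b + 5 * \<delta>)"
  have rad: "real (rad n) \<le> Y powr (mass (log_part Y n0) + 5 * \<delta>)" if "same_size \<delta> Y n n0" "0 < n" for n n0
    using sum_same_size[OF that(1), of "{1..5}" "\<lambda>_. 1" 5] \<delta> Y
    by (simp add: rad_eq_powr[OF Y that(2)] mass_def)
  have rad1: "rad (1::nat) = 1" by (simp add: rad_def)
  have main: "real (card W) \<le> 3 * (K * Y powr \<delta>) ^ 3 * (RA * RB * 1) *
      ((L * Y powr \<delta>)\<^sup>2 * (1 + 36 * 1 ^ 4 * (1 * 1 * Y) / Y))"
  proof (rule card_factored_le[of 1, OF _ W(1), where x = "\<lambda>_. 1" and y = "\<lambda>_. 1"
        and A = id and B = id and C = "\<lambda>_. 1"])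
    fix p q m assume t: "(p, q, m) \<in> W"
    show "real (rad (id p)) \<le> RA \<and> real (rad (id q)) \<le> RB \<and> real (rad (1::nat)) \<le> 1"
      using rad box[OF t] sum_triples_facts[OF t] rad1 by (simp add: RA_def RB_def)
    show "p = id p * 1 ^ 1 \<and> q = id q * 1 ^ 1 \<and> 1 dvd m \<and> real m \<le> real (1::nat) * Y"
      using sum_triples_facts[OF t] by auto
  qed (use sum_triples_facts sum_triples_relation[OF subsetD[OF W(2)]] Y K(2) L(2) in \<open>auto simp: RA_def RB_def\<close>)
  also have "\<dots> = 3 * K ^ 3 * L\<^sup>2 * 37 * (Y powr (3 * \<delta>) * (RA * RB) * Y powr (2 * \<delta>))"
    using Y by (simp add: power_mult_distrib powr_realpow[symmetric] powr_powr mult.commute)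
  also have "Y powr (3 * \<delta>) * (RA * RB) * Y powr (2 * \<delta>) = Y powr (mass ?a + mass ?b + 15 * \<delta>)"
    by (simp add: RA_def RB_def powr_add[symmetric] algebra_simps)
  also have "3 * K ^ 3 * L\<^sup>2 * 37 * Y powr (mass ?a + mass ?b + 15 * \<delta>) \<le>
      3 * K ^ 3 * L\<^sup>2 * 37 * Y powr (mass ?a + mass ?b + mass ?c - g + 200 * \<delta>)"
    using assms \<delta> Y K(1) L(1) by (intro mult_left_mono) auto
  finally show ?thesis by simp
qed

end

section \<open>Counting abc triples\<close>

lemma sum_triples_permute:
  assumes "(p, q, m) \<in> sum_triples Y"
  shows "(q, m, p) \<in> sum_triples Y" "(p, m, q) \<in> sum_triples Y"
proof -
  obtain j where j: "summand_relation j (p, q, m)"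
    using sum_triples_relation[OF assms] by blast
  have "coprime p q" using assms by (simp add: sum_triples_def)
  note c = summand_relation_coprime[OF j this]
  have "{q, m, p} = {p, q, m}" "{p, m, q} = {p, q, m}" by auto
  then show "(q, m, p) \<in> sum_triples Y" "(p, m, q) \<in> sum_triples Y"
    using assms c by (auto simp: sum_triples_def add.commute)
qed

text \<open>If no mass reaches \<open>g\<close>, the linear program provides a strategy; otherwise
  trivial counting gains \<open>g\<close>. The maps \<open>r\<close> and \<open>s\<close> move
  \<open>p\<close> or \<open>q\<close> into the place of the modulus.\<close>

lemma card_box_le:
  fixes \<delta> Y K L :: real
  assumes Y: "1 < Y" and \<delta>: "0 < \<delta>"
    and K: "1 \<le> K" "\<And>R. 0 \<le> R \<Longrightarrow> finite {n::nat. 0 < n \<and> real n \<le> Y \<and> real (rad n) \<le> R} \<and>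
      real (card {n::nat. 0 < n \<and> real n \<le> Y \<and> real (rad n) \<le> R}) \<le> K * Y powr \<delta> * R"
    and L: "1 \<le> L" "\<And>n::nat. 0 < n \<Longrightarrow> real n \<le> Y \<Longrightarrow> real (card {d. d dvd n}) \<le> L * Y powr \<delta>"
    and W: "finite W" "W \<subseteq> sum_triples Y"
    and box: "\<And>p q m. (p, q, m) \<in> W \<Longrightarrow> same_size \<delta> Y p p0 \<and> same_size \<delta> Y q q0 \<and> same_size \<delta> Y m m0"
    and t0: "0 < p0" "p0 \<le> Y" "0 < q0" "q0 \<le> Y" "0 < m0" "m0 \<le> Y"
    and mu: "\<mu> = mass (log_part Y p0) + mass (log_part Y q0) + mass (log_part Y m0)" "\<mu> \<le> 2"
  shows "real (card W) \<le> 111 * K ^ 3 * L\<^sup>2 * Y powr ((23 * \<mu> + 3) / 40 + 200 * \<delta>)"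
proof -
  define g where "g = (17 * \<mu> - 3) / 40"
  let ?a = "log_part Y p0" and ?b = "log_part Y q0" and ?c = "log_part Y m0"
  have card_perm: "card (f ` W) = card W" if "inj f" for f :: "nat \<times> nat \<times> nat \<Rightarrow> nat \<times> nat \<times> nat"
    using that by (meson card_image inj_on_subset subset_UNIV)
  define r where "r = (\<lambda>(p, q, m). (q, m, p) :: nat \<times> nat \<times> nat)"
  define s where "s = (\<lambda>(p, q, m). (p, m, q) :: nat \<times> nat \<times> nat)"
  have inj: "inj r" "inj s" by (auto simp: r_def s_def inj_on_def)
  have perm: "r t \<in> sum_triples Y" "s t \<in> sum_triples Y" if "t \<in> W" for t
    using sum_triples_permute[of "fst t" "fst (snd t)" "snd (snd t)" Y] subsetD[OF W(2) that]
    by (simp_all add: r_def s_def split_beta)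
  have rW: "finite (r ` W)" "r ` W \<subseteq> sum_triples Y" and sW: "finite (s ` W)" "s ` W \<subseteq> sum_triples Y"
    using W(1) perm by blast+
  have rbox: "same_size \<delta> Y q q0 \<and> same_size \<delta> Y m m0 \<and> same_size \<delta> Y p p0"
    if "(q, m, p) \<in> r ` W" for p q m
    using that box by (auto simp: r_def)
  have sbox: "same_size \<delta> Y p p0 \<and> same_size \<delta> Y m m0 \<and> same_size \<delta> Y q q0"
    if "(p, m, q) \<in> s ` W" for p q m
    using that box by (auto simp: s_def)
  note strat = card_box_le_strategy[OF Y \<delta> K L W box] card_box_le_strategy[OF Y \<delta> K L rW rbox]
    card_box_le_strategy[OF Y \<delta> K L sW sbox]
  note triv = card_box_le_trivial[OF Y \<delta> K L W box] card_box_le_trivial[OF Y \<delta> K L rW rbox]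
    card_box_le_trivial[OF Y \<delta> K L sW sbox]
  have mass: "mass a = a 1 + a 2 + a 3 + a 4 + a 5" for a
    by (simp add: mass_def numeral_eq_Suc)
  have V: "a 1 + 2 * a 2 + 3 * a 3 + 4 * a 4 + 5 * a 5 \<le> 1"
    if "(\<Sum>i\<in>{1..5}. real i * a i) \<le> 1" for a
    using that by (simp add: numeral_eq_Suc)
  have "strategy ?a ?b ?c g \<or> strategy ?b ?c ?a g \<or> strategy ?a ?c ?b g \<or>
      g \<le> mass ?a \<or> g \<le> mass ?b \<or> g \<le> mass ?c"
  proof (rule ccontr)
    assume n: "\<not> ?thesis"
    have "strategy ?a ?b ?c g \<or> strategy ?b ?c ?a g \<or> strategy ?a ?c ?b g"
      by (rule strategy_exists[where mu = \<mu>])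
        (use n mu t0 in \<open>auto simp: g_def mass[symmetric] not_le log_part_nonneg[OF Y]
          intro!: V sum_log_part_le[OF Y] simp del: One_nat_def\<close>)
    then show False using n by blast
  qed
  then have "real (card W) \<le> 111 * K ^ 3 * L\<^sup>2 * Y powr (\<mu> - g + 200 * \<delta>)"
  proof (elim disjE)
    assume "strategy ?a ?b ?c g" then show ?thesis
      using strat(1)[of g] by (simp add: mu)
  next
    assume "strategy ?b ?c ?a g" then show ?thesis
      using strat(2)[of g] by (simp add: mu card_perm inj algebra_simps)
  next
    assume "strategy ?a ?c ?b g" then show ?thesis
      using strat(3)[of g] by (simp add: mu card_perm inj algebra_simps)
  next
    assume "g \<le> mass ?a" then show ?thesis
      using triv(2)[of g] by (simp add: mu card_perm inj algebra_simps)
  next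
    assume "g \<le> mass ?b" then show ?thesis
      using triv(3)[of g] by (simp add: mu card_perm inj algebra_simps)
  next
    assume "g \<le> mass ?c" then show ?thesis
      using triv(1)[of g] by (simp add: mu)
  qed
  moreover have "\<mu> - g = (23 * \<mu> + 3) / 40"
    by (simp add: g_def field_simps)
  ultimately show ?thesis by simp
qed

section \<open>Dyadic ranges of c and their summation\<close>

definition abc_triples_between :: "real \<Rightarrow> real \<Rightarrow> (nat \<times> nat \<times> nat) set" where
  "abc_triples_between l Y = {(a, b, c). abc_triple l (a, b, c) \<and> Y / 2 < real c \<and> real c \<le> Y}"

lemma abc_triples_between_subset: "abc_triples_between l Y \<subseteq> sum_triples Y"
proof
  fix t assume t: "t \<in> abc_triples_between l Y"
  obtain a b c where eq: "t = (a, b, c)" by (metis surj_pair)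
  have abc: "0 < a" "0 < b" "a + b = c" "gcd (gcd a b) c = 1" "Y / 2 < real c" "real c \<le> Y"
    using t by (auto simp: abc_triples_between_def abc_triple_def eq)
  then have "coprime a b"
    by (metis coprime_iff_gcd_eq_1 dvd_add gcd_dvd1 gcd_dvd2 gcd_nat.absorb1)
  moreover have "Max {a, b, c} = c" using abc by (auto simp: max_def)
  ultimately show "t \<in> sum_triples Y"
    using abc by (auto simp: sum_triples_def eq)
qed

text \<open>By pairwise coprimality the masses add up to the logarithm of
  \<open>rad (a * b * c)\<close>, which the exponent \<open>l\<close> controls.\<close>

lemma abc_mass_le:
  assumes "1 < Y" "0 < l" "(a, b, c) \<in> abc_triples_between l Y"
  shows "mass (log_part Y a) + mass (log_part Y b) + mass (log_part Y c) \<le> l"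
proof -
  have s: "(a, b, c) \<in> sum_triples Y"
    using assms(3) abc_triples_between_subset by blast
  have pos: "0 < a" "0 < b" "0 < c" "coprime a b"
    using s by (auto simp: sum_triples_def)
  have cop: "coprime a c" "coprime b c"
    using summand_relation_coprime[of 0 a b c] assms(3) pos
    by (auto simp: abc_triples_between_def abc_triple_def summand_relation_def)
  have c: "real c \<le> Y" "real (rad (a * b * c)) < real c powr l"
    using assms(3) by (auto simp: abc_triples_between_def abc_triple_def)
  have "rad (a * b * c) = rad a * rad b * rad c"
    using pos cop by (simp add: rad_mult_coprime)
  then have "Y powr (mass (log_part Y a) + mass (log_part Y b) + mass (log_part Y c)) =
      real (rad (a * b * c))"
    using pos by (simp add: rad_eq_powr[OF assms(1)] mass_def powr_add)
  also have "\<dots> \<le> Y powr l"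
    using c powr_mono2[of l "real c" Y] assms(2) by linarith
  finally show ?thesis
    by (simp only: powr_le_cancel_iff[OF assms(1)])
qed

text \<open>All 15 logarithmic coordinates lie in [0, 1], so a grid of mesh \<delta> has boundedly
  many boxes, independently of \<open>Y\<close> and \<open>l\<close>, and \<open>card_box_le\<close>
  applies to each.\<close>

lemma dyadic_count:
  assumes "0 < \<epsilon>"
  obtains K where "0 < K" "\<And>l Y. 0 < l \<Longrightarrow> l \<le> 2 \<Longrightarrow> 1 < Y \<Longrightarrow>
    real (card (abc_triples_between l Y)) \<le> K * Y powr ((23 * l + 3) / 40 + \<epsilon>)"
proof -
  define \<delta> where "\<delta> = \<epsilon> / 200"
  have \<delta>: "0 < \<delta>" using assms by (simp add: \<delta>_def)
  obtain K where K: "1 \<le> K" "\<And>Y R. 0 < Y \<Longrightarrow> 0 \<le> R \<Longrightarrow>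
    finite {n::nat. 0 < n \<and> real n \<le> Y \<and> real (rad n) \<le> R} \<and>
    real (card {n::nat. 0 < n \<and> real n \<le> Y \<and> real (rad n) \<le> R}) \<le> K * Y powr \<delta> * R"
    by (rule rad_count[OF \<delta>], rule that)
  obtain L where L: "1 \<le> L" "\<And>n::nat. 0 < n \<Longrightarrow> real (card {d. d dvd n}) \<le> L * real n powr \<delta>"
    by (rule divisor_bound[OF \<delta>], rule that)
  define J where "J = nat \<lfloor>1 / \<delta>\<rfloor>"
  define I where "I = Pi\<^sub>E ({..<3::nat} \<times> {1..5::nat}) (\<lambda>_. {..J})"
  have finI: "finite I" by (auto simp: I_def intro!: finite_PiE)
  define C where "C = 111 * K ^ 3 * L\<^sup>2"
  have C: "0 < C" using K L by (simp add: C_def)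
  show ?thesis
  \<comment> \<open>The summand 1 only makes the constant visibly positive.\<close>
  proof (rule that[of "real (card I) * C + 1"])
    show "0 < real (card I) * C + 1" using C by (simp add: add_nonneg_pos)
    fix l Y :: real assume l: "0 < l" "l \<le> 2" and Y: "1 < Y"
    define W where "W = abc_triples_between l Y"
    have finW: "finite W"
      by (rule finite_subset[OF _ finite_abc_triples_upto[of l Y]])
        (auto simp: W_def abc_triples_between_def abc_triples_upto_def abc_triple_def)
    have WS: "W \<subseteq> sum_triples Y"
      using abc_triples_between_subset by (simp add: W_def)
    define comp where "comp = (\<lambda>(a, b, c) (j::nat). if j = 0 then a else if j = 1 then b else c :: nat)"
    define key where "key = (\<lambda>t. restrict (\<lambda>(j, i). nat \<lfloor>log_part Y (comp t j) i / \<delta>\<rfloor>) ({..<3::nat} \<times> {1..5::nat}))"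
    have sz: "0 < comp t j \<and> real (comp t j) \<le> Y" if "t \<in> W" for t j
      using that WS by (fastforce simp: sum_triples_def comp_def)
    have key: "key t \<in> I" if "t \<in> W" for t
      unfolding I_def key_def
    proof (rule restrict_PiE_iff[THEN iffD2], safe)
      fix j i :: nat assume "i \<in> {1..5}"
      then have "log_part Y (comp t j) i / \<delta> \<le> 1 / \<delta>"
        using sz[OF that] \<delta> by (intro divide_right_mono log_part_le_1[OF Y]) auto
      then show "nat \<lfloor>log_part Y (comp t j) i / \<delta>\<rfloor> \<le> J"
        unfolding J_def by (intro nat_mono floor_mono)
    qed
    have same: "same_size \<delta> Y (comp t j) (comp t' j)" if "key t = key t'" "j < 3" for t t' j
      unfolding same_size_def
    proof
      fix i :: nat assume i: "i \<in> {1..5}"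
      let ?x = "log_part Y (comp t j) i" and ?y = "log_part Y (comp t' j) i"
      have "nat \<lfloor>?x / \<delta>\<rfloor> = nat \<lfloor>?y / \<delta>\<rfloor>"
        using fun_cong[OF that(1), of "(j, i)"] that(2) i by (simp add: key_def)
      moreover have "0 \<le> ?x / \<delta>" "0 \<le> ?y / \<delta>"
        using log_part_nonneg[OF Y] \<delta> by auto
      ultimately have "\<lfloor>?x / \<delta>\<rfloor> = \<lfloor>?y / \<delta>\<rfloor>"
        by (simp add: nat_eq_iff)
      then have "\<bar>?x / \<delta> - ?y / \<delta>\<bar> \<le> 1" by linarith
      then have "\<bar>?x - ?y\<bar> / \<delta> \<le> 1"
        using \<delta> by (simp add: diff_divide_distrib[symmetric] abs_divide)
      then show "\<bar>?x - ?y\<bar> \<le> \<delta>"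
        using \<delta> by (simp add: field_simps)
    qed
    have "W = (\<Union>z\<in>I. {t \<in> W. key t = z})"
      using key by auto
    then have "real (card W) = real (card (\<Union>z\<in>I. {t \<in> W. key t = z}))" by simp
    also have "\<dots> \<le> real (card I) * (C * Y powr ((23 * l + 3) / 40 + \<epsilon>))"
    proof (rule card_UN_le_mult[OF finI])
      fix z
      show "real (card {t \<in> W. key t = z}) \<le> C * Y powr ((23 * l + 3) / 40 + \<epsilon>)"
      proof (cases "{t \<in> W. key t = z} = {}")
        case True
        then show ?thesis using C by (simp only: True card.empty) simp
      next
        case False
        then obtain a b c where t0: "(a, b, c) \<in> W" "key (a, b, c) = z" by auto
        define \<mu> where "\<mu> = mass (log_part Y a) + mass (log_part Y b) + mass (log_part Y c)"
        have \<mu>: "\<mu> \<le> l"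
          using abc_mass_le[OF Y l(1)] t0 by (simp add: \<mu>_def W_def)
        have "real (card {t \<in> W. key t = z}) \<le> C * Y powr ((23 * \<mu> + 3) / 40 + 200 * \<delta>)"
          unfolding C_def
        proof (rule card_box_le[OF Y \<delta> K(1) _ L(1) _ _ _ _ _ _ _ _ _ _ \<mu>_def])
          show "finite {t \<in> W. key t = z}" "{t \<in> W. key t = z} \<subseteq> sum_triples Y"
            using finW WS by auto
          show "0 < a" "real a \<le> Y" "0 < b" "real b \<le> Y" "0 < c" "real c \<le> Y"
            using sz[OF t0(1), of 0] sz[OF t0(1), of 1] sz[OF t0(1), of 2] by (auto simp: comp_def)
          show "\<mu> \<le> 2" using \<mu> l by simp
          show "real (card {d. d dvd n}) \<le> L * Y powr \<delta>" if "0 < n" "real n \<le> Y" for n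
          proof -
            have "real n powr \<delta> \<le> Y powr \<delta>"
              using that \<delta> by (intro powr_mono2) auto
            then show ?thesis
              using L(2)[OF that(1)] L(1) by (smt (verit) mult_left_mono)
          qed
          fix p q m assume "(p, q, m) \<in> {t \<in> W. key t = z}"
          then have "key (p, q, m) = key (a, b, c)" using t0 by simp
          then show "same_size \<delta> Y p a \<and> same_size \<delta> Y q b \<and> same_size \<delta> Y m c"
            using same[of "(p, q, m)" "(a, b, c)" 0] same[of "(p, q, m)" "(a, b, c)" 1]
              same[of "(p, q, m)" "(a, b, c)" 2] by (simp add: comp_def)
        qed (use K(2) Y in auto)
        \<comment> \<open>The box bound involves the mass \<mu> of its reference triple; it
          increases with \<mu>, and \<mu> is at most \<open>l\<close>.\<close>
        also have "\<dots> \<le> C * Y powr ((23 * l + 3) / 40 + \<epsilon>)"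
          using \<mu> C Y by (intro mult_left_mono powr_mono) (auto simp: \<delta>_def)
        finally show ?thesis .
      qed
    qed
    also have "\<dots> \<le> (real (card I) * C + 1) * Y powr ((23 * l + 3) / 40 + \<epsilon>)"
      by (simp add: algebra_simps)
    finally show "real (card (abc_triples_between l Y)) \<le>
        (real (card I) * C + 1) * Y powr ((23 * l + 3) / 40 + \<epsilon>)"
      by (simp add: W_def)
  qed
qed

text \<open>Halving \<open>X\<close> repeatedly gives a geometric series. Its ratio is at most
  \<open>q = 2 powr (- \<epsilon>)\<close>, which keeps the constant independent of
  \<open>l\<close>.\<close>

lemma abc_count_bound:
  assumes "0 < \<epsilon>"
  obtains K where "\<And>l X. 0 < l \<Longrightarrow> l \<le> 2 \<Longrightarrow> 0 < X \<Longrightarrow>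
    real (abc_count l X) \<le> K * X powr ((23 * l + 3) / 40 + \<epsilon>)"
proof -
  obtain K where K: "0 < K" "\<And>l Y. 0 < l \<Longrightarrow> l \<le> 2 \<Longrightarrow> 1 < Y \<Longrightarrow>
    real (card (abc_triples_between l Y)) \<le> K * Y powr ((23 * l + 3) / 40 + \<epsilon>)"
    by (rule dyadic_count[OF assms], rule that)
  define q where "q = (1 / 2 :: real) powr \<epsilon>"
  have q: "0 < q" "q < 1"
    using assms powr_less_mono'[of "1/2" 0 \<epsilon>] by (auto simp: q_def)
  \<comment> \<open>The solution of \<open>K' * q + K = K'\<close>, so that the induction step
    returns the same constant.\<close>
  define K' where "K' = K / (1 - q)"
  have K': "0 < K'" "K' * q + K = K'"
    using K q by (auto simp: K'_def field_simps)
  have bound: "\<forall>X>0. X < 2 ^ n \<longrightarrow> real (abc_count l X) \<le> K' * X powr ((23 * l + 3) / 40 + \<epsilon>)"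
    if l: "0 < l" "l \<le> 2" for l and n :: nat
  proof (induction n)
    case 0
    have "abc_triples_upto l X = {}" if "X < 1" for X
      using that by (auto simp: abc_triples_upto_def)
    then show ?case
      using K' by (simp add: abc_count_def)
  next
    case (Suc n)
    show ?case
    proof (intro allI impI)
      fix X :: real assume X: "0 < X" "X < 2 ^ Suc n"
      let ?e = "(23 * l + 3) / 40 + \<epsilon>"
      show "real (abc_count l X) \<le> K' * X powr ?e"
      proof (cases "X \<le> 1")
        case True
        \<comment> \<open>The sum of two positive integers is at least 2.\<close>
        have "\<not> (a, b, c) \<in> abc_triples_upto l X" for a b c
        proof
          assume "(a, b, c) \<in> abc_triples_upto l X"
          then have "0 < a" "0 < b" "a + b = c" "real c \<le> X"
            by (auto simp: abc_triples_upto_def abc_triple_def)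
          then show False using True by linarith
        qed
        then have "abc_triples_upto l X = {}"
          by auto
        then show ?thesis using K' by (simp add: abc_count_def)
      next
        case False
        have fin: "finite (abc_triples_between l X)"
          by (rule finite_subset[OF _ finite_abc_triples_upto[of l X]])
            (auto simp: abc_triples_between_def abc_triples_upto_def abc_triple_def)
        have "abc_triples_upto l X \<subseteq> abc_triples_between l X \<union> abc_triples_upto l (X / 2)"
          by (auto simp: abc_triples_upto_def abc_triples_between_def abc_triple_def)
        then have "abc_count l X \<le> card (abc_triples_between l X \<union> abc_triples_upto l (X / 2))"
          unfolding abc_count_def using fin finite_abc_triples_upto by (intro card_mono) auto
        also have "\<dots> \<le> card (abc_triples_between l X) + abc_count l (X / 2)"
          unfolding abc_count_def by (rule card_Un_le)
        finally have "real (abc_count l X) \<le> real (card (abc_triples_between l X)) + real (abc_count l (X / 2))"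
          by linarith
        also have "\<dots> \<le> K * X powr ?e + K' * (X / 2) powr ?e"
          using K(2)[OF l, of X] Suc.IH X False by (intro add_mono) auto
        also have "(X / 2) powr ?e = X powr ?e * (1 / 2) powr ?e"
          using X powr_mult[of X "1 / 2" ?e] by simp
        also have "(1 / 2 :: real) powr ?e \<le> q"
          unfolding q_def using l by (intro powr_mono') auto
        then have "K * X powr ?e + K' * (X powr ?e * (1 / 2) powr ?e) \<le> K * X powr ?e + K' * (X powr ?e * q)"
          using K' by (intro add_left_mono mult_left_mono) auto
        also have "\<dots> = (K' * q + K) * X powr ?e"
          by (simp add: algebra_simps)
        finally show ?thesis by (simp only: K'(2))
      qed
    qed
  qed
  show ?thesis
  proof (rule that[of K'])
    fix l X :: real assume "0 < l" "l \<le> 2" "0 < X"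
    moreover obtain n :: nat where "X < 2 ^ n"
      using real_arch_pow[of 2 X] by auto
    ultimately show "real (abc_count l X) \<le> K' * X powr ((23 * l + 3) / 40 + \<epsilon>)"
      using bound by blast
  qed
qed

theorem theorem1p2:
  shows "(\<forall>\<epsilon>::real. \<epsilon> > 0 \<longrightarrow> (\<exists>K::real. \<forall>l::real. 0 < l \<and> l \<le> 2 \<longrightarrow> (\<forall>X::real. X \<ge> 1 \<longrightarrow>
            \<bar>real (abc_count l X)\<bar> \<le> K * X powr ((23 * l + 3) / 40 + \<epsilon>))))
       \<and> (\<forall>l::real. 0 < l \<and> l < 1 \<longrightarrow> (\<exists>K::real. \<forall>X::real. X \<ge> 1 \<longrightarrow>
            \<bar>real (abc_count l X)\<bar> \<le> K * X powr (65 / 100)))"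
proof (intro conjI allI impI)
  fix \<epsilon> :: real assume \<epsilon>: "0 < \<epsilon>"
  obtain K where "\<And>l X. 0 < l \<Longrightarrow> l \<le> 2 \<Longrightarrow> 0 < X \<Longrightarrow>
    real (abc_count l X) \<le> K * X powr ((23 * l + 3) / 40 + \<epsilon>)"
    by (rule abc_count_bound[OF \<epsilon>], rule that)
  then show "\<exists>K. \<forall>l. 0 < l \<and> l \<le> 2 \<longrightarrow> (\<forall>X\<ge>1.
      \<bar>real (abc_count l X)\<bar> \<le> K * X powr ((23 * l + 3) / 40 + \<epsilon>))"
    by (intro exI[of _ K]) auto
next
  fix l :: real assume l: "0 < l \<and> l < 1"
  \<comment> \<open>At \<open>l = 1\<close> the exponent (23 * l + 3) / 40 is exactly 0.65, so for
    \<open>l < 1\<close> the difference is a positive \<epsilon> depending on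
    \<open>l\<close>.\<close>
  define \<epsilon> where "\<epsilon> = 65 / 100 - (23 * l + 3) / 40"
  have \<epsilon>: "0 < \<epsilon>" using l by (simp add: \<epsilon>_def field_simps)
  obtain K where K: "\<And>l X. 0 < l \<Longrightarrow> l \<le> 2 \<Longrightarrow> 0 < X \<Longrightarrow>
    real (abc_count l X) \<le> K * X powr ((23 * l + 3) / 40 + \<epsilon>)"
    by (rule abc_count_bound[OF \<epsilon>], rule that)
  have eq: "(23 * l + 3) / 40 + \<epsilon> = 65 / 100"
    by (simp add: \<epsilon>_def)
  have "\<bar>real (abc_count l X)\<bar> \<le> K * X powr (65 / 100)" if "1 \<le> X" for X
    using K[of l X, unfolded eq] l that by simp
  then show "\<exists>K. \<forall>X\<ge>1. \<bar>real (abc_count l X)\<bar> \<le> K * X powr (65 / 100)"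
    by blast
qed

end
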